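(* Let $\mathbf{k}$ be a field and $\Gamma$ a $(d-1)$-dimensional simplicial complex on $[n]$ with upper skips $1=Q_0<Q_1<\dots<Q_{d-1}$. For $1\le i\le d-1$ set $$c_i=\prod_{1\le u\le d-1,\,u\neq i}Q_u(Q_u-1)\prod_{1\le u<v\le d-1,\ u,v\neq i}(Q_v-Q_u).$$ Then $f_{d-1}(\Gamma)\le\frac{1}{(n-d)!}\prod_{i=1}^{n-d}M_i(S/I_\Gamma)$ if and only if $$\sum_{i=1}^{d-1}c_i\sum_{j=0}^{i-1}(-1)^{i-j-1}A(j,Q_i)\ge0.$$
   Context: A simplicial complex on $[n]$ is a family of subsets closed under subsets containing all singletons; $f_i$ counts faces of size $i+1$. For $S=\mathbf{k}[x_1,\dots,x_n]$ and Stanley–Reisner ideal $I_\Gamma$, $M_i=\max\{|W|:W\subseteq[n],\ \tilde H_{|W|-i-1}(\Gamma[W];\mathbf{k})\neq0\}$ (maximal shifts of the minimal free resolution of $S/I_\Gamma$). For $1\le i\le n-d$ these are strictly increasing integers in $\{2,\dots,n\}$; the $d$ elements of $[n]$ not among $M_1,\dots,M_{n-d}$ are the upper skips $Q_0=1<Q_1<\dots<Q_{d-1}$. For $0\le p<d$ and $1\le m\le n$, $A(p,m)=\binom{n}{m}^{-1}\sum_{W\subseteq[n],|W|=m}\tilde\beta_p(\Gamma[W];\mathbf{k})$, where $\tilde\beta_p=\dim_{\mathbf{k}}\tilde H_p$ and $\Gamma[W]$ is the induced subcomplex. *)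

theory Defs
  imports Complex_Main "HOL-Library.Function_Algebras"
begin

definition simplicial_complex :: "nat \<Rightarrow> nat set set \<Rightarrow> bool" where
  "simplicial_complex n \<Gamma> \<longleftrightarrow>
     \<Gamma> \<subseteq> Pow {1..n} \<and> {} \<in> \<Gamma> \<and>
     (\<forall>\<sigma>\<in>\<Gamma>. \<forall>\<tau>. \<tau> \<subseteq> \<sigma> \<longrightarrow> \<tau> \<in> \<Gamma>) \<and>
     (\<forall>i\<in>{1..n}. {i} \<in> \<Gamma>)"

definition fvec :: "nat set set \<Rightarrow> nat \<Rightarrow> nat" where
  "fvec \<Gamma> i = card {\<sigma>\<in>\<Gamma>. card \<sigma> = i + 1}"

definition induced :: "nat set set \<Rightarrow> nat set \<Rightarrow> nat set set" where
  "induced \<Gamma> W = {\<sigma>\<in>\<Gamma>. \<sigma> \<subseteq> W}"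

text \<open>Chain space C_q (augmented: the empty face is the unique (-1)-face):
  k-valued functions supported on faces of size q+1.\<close>
definition chains :: "'k::field itself \<Rightarrow> nat set set \<Rightarrow> int \<Rightarrow> (nat set \<Rightarrow> 'k) set" where
  "chains K \<Delta> q = {c. \<forall>\<sigma>. c \<sigma> \<noteq> 0 \<longrightarrow> \<sigma> \<in> \<Delta> \<and> int (card \<sigma>) = q + 1}"

text \<open>Simplicial boundary map with vertices oriented by their natural order:
  the face (v_0 < ... < v_q) is sent to sum_j (-1)^j (v_0..v_j-hat..v_q).
  On 0-chains this is the augmentation map to C_{-1}.\<close>
definition bd :: "nat set set \<Rightarrow> (nat set \<Rightarrow> 'k::field) \<Rightarrow> (nat set \<Rightarrow> 'k)" where
  "bd \<Delta> c = (\<lambda>\<sigma>. \<Sum>v\<in>(\<Union>\<Delta>) - \<sigma>. (-1) ^ card {u\<in>\<sigma>. u < v} * c (insert v \<sigma>))"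

definition rbetti :: "'k::field itself \<Rightarrow> nat set set \<Rightarrow> int \<Rightarrow> nat" where
  "rbetti K \<Delta> q =
     vector_space.dim (\<lambda>(a::'k) (f::nat set \<Rightarrow> 'k) x. a * f x) {c \<in> chains K \<Delta> q. bd \<Delta> c = (\<lambda>_. 0)}
     - vector_space.dim (\<lambda>(a::'k) (f::nat set \<Rightarrow> 'k) x. a * f x) (bd \<Delta> ` chains K \<Delta> (q + 1))"

definition Mshift :: "'k::field itself \<Rightarrow> nat \<Rightarrow> nat set set \<Rightarrow> nat \<Rightarrow> nat" where
  "Mshift K n \<Gamma> i = Max {card W | W. W \<subseteq> {1..n} \<and>
       rbetti K (induced \<Gamma> W) (int (card W) - int i - 1) \<noteq> 0}"

definition upper_skip :: "'k::field itself \<Rightarrow> nat \<Rightarrow> nat \<Rightarrow> nat set set \<Rightarrow> nat \<Rightarrow> nat" where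
  "upper_skip K n d \<Gamma> k =
     sorted_list_of_set ({1..n} - Mshift K n \<Gamma> ` {1..n - d}) ! k"

definition Aavg :: "'k::field itself \<Rightarrow> nat \<Rightarrow> nat set set \<Rightarrow> nat \<Rightarrow> nat \<Rightarrow> real" where
  "Aavg K n \<Gamma> p m = (\<Sum>W\<in>{W. W \<subseteq> {1..n} \<and> card W = m}. real (rbetti K (induced \<Gamma> W) (int p)))
                       / real (n choose m)"

definition ccoef :: "(nat \<Rightarrow> nat) \<Rightarrow> nat \<Rightarrow> nat \<Rightarrow> real" where
  "ccoef Q d i =
     (\<Prod>u\<in>{1..d-1} - {i}. real (Q u) * (real (Q u) - 1)) *
     (\<Prod>(u,v)\<in>{(u,v). u \<in> {1..d-1} - {i} \<and> v \<in> {1..d-1} - {i} \<and> u < v}. real (Q v) - real (Q u))"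

end

theory Submission
  imports Defs "HOL-Computational_Algebra.Polynomial"
begin

text \<open>
  The average over all \<open>W\<close> of size \<open>m\<close> of the reduced Euler characteristic of \<open>\<Gamma>[W]\<close> is, by
  Euler--Poincare and double counting, a polynomial in \<open>m\<close> of degree at most \<open>d\<close> whose leading
  coefficient is a multiple of \<open>f\<^sub>d\<^sub>-\<^sub>1\<close>. Lagrange interpolation at the nodes \<open>0, Q\<^sub>0 = 1, Q\<^sub>1, \<dots>, Q\<^sub>d\<^sub>-\<^sub>1\<close>
  expresses that coefficient by the values at the skips, where the Betti numbers in degrees \<open>\<ge> i\<close>
  vanish at \<open>Q\<^sub>i\<close>. Together with \<open>\<Prod>M\<^sub>i \<cdot> \<Prod>Q\<^sub>u = n!\<close> this is the criterion.

  The vanishing rests on \<open>M\<^sub>0 < M\<^sub>1 < \<dots> < M\<^sub>n\<^sub>-\<^sub>d\<close>. If a non-zero class on \<open>\<Gamma>[W]\<close> contributing to \<open>M\<^sub>i\<close>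
  could not be continued to a larger set contributing to \<open>M\<^sub>i\<^sub>+\<^sub>1\<close>, then repeated Mayer--Vietoris
  arguments would push it into the link of all vertices outside \<open>W\<close>, and \<open>\<Gamma>\<close> would have a face with
  \<open>n - i > d\<close> vertices.
\<close>

section \<open>Homology of links\<close>

text \<open>Signed removal of the vertex \<open>v\<close>, the interior product of the exterior
  algebra. The boundary is a sum of such operators; they square to zero and anticommute, which turns
  the Mayer-Vietoris arguments into algebra.\<close>

definition contract :: "nat \<Rightarrow> (nat set \<Rightarrow> 'k::field) \<Rightarrow> nat set \<Rightarrow> 'k" where
  "contract v c = (\<lambda>\<sigma>. if v \<in> \<sigma> then 0 else (-1) ^ card {u\<in>\<sigma>. u < v} * c (insert v \<sigma>))"

text \<open>The sum runs over a fixed ambient set \<open>X\<close>, so that one operator serves a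
  complex, its induced subcomplexes and its links; \<open>bd_eq_boundary\<close> relates it to
  \<open>bd\<close>.\<close>

definition boundary :: "nat set \<Rightarrow> (nat set \<Rightarrow> 'k::field) \<Rightarrow> nat set \<Rightarrow> 'k" where
  "boundary X c = (\<lambda>\<sigma>. \<Sum>v\<in>X. contract v c \<sigma>)"

text \<open>Graded by the number \<open>s\<close> of vertices: the homological degree is
  \<open>s - 1\<close>, and the empty face sits at \<open>s = 0\<close>.\<close>

definition size_chains :: "nat set set \<Rightarrow> nat \<Rightarrow> (nat set \<Rightarrow> 'k::field) set" where
  "size_chains \<Delta> s = {c. \<forall>\<sigma>. c \<sigma> \<noteq> 0 \<longrightarrow> \<sigma> \<in> \<Delta> \<and> card \<sigma> = s}"

definition down_closed :: "nat set set \<Rightarrow> bool" where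
  "down_closed \<Delta> \<longleftrightarrow> (\<forall>\<sigma>\<in>\<Delta>. finite \<sigma> \<and> (\<forall>\<tau>. \<tau> \<subseteq> \<sigma> \<longrightarrow> \<tau> \<in> \<Delta>))"

definition link :: "nat \<Rightarrow> nat set set \<Rightarrow> nat set set" where
  "link v \<Delta> = {\<sigma>. v \<notin> \<sigma> \<and> insert v \<sigma> \<in> \<Delta>}"

section \<open>Algebra of contractions and boundaries\<close>

lemma card_less_insert:
  fixes v w :: nat
  assumes "v \<notin> \<sigma>"
  shows "card {u \<in> insert v \<sigma>. u < w} = card {u\<in>\<sigma>. u < w} + (if v < w then 1 else 0 :: nat)"
proof -
  have "finite {u\<in>\<sigma>. u < w}" by (rule finite_subset[of _ "{..<w}"]) auto
  moreover have "{u \<in> insert v \<sigma>. u < w} = (if v < w then insert v {u\<in>\<sigma>. u < w} else {u\<in>\<sigma>. u < w})"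
    by auto
  ultimately show ?thesis using assms by simp
qed

text \<open>The vertex added to \<open>\<sigma>\<close> first shifts the position of the other one
  exactly when it is the smaller of the two, so the two orders differ by one sign. In the degenerate
  cases both sides vanish.\<close>

lemma contract_anticommute: "contract v (contract w c) \<sigma> = - contract w (contract v c) \<sigma>"
proof (cases "v \<in> \<sigma> \<or> w \<in> \<sigma> \<or> v = w")
  case True
  then show ?thesis by (auto simp: contract_def)
next
  case False
  then show ?thesis
    by (cases "v < w") (simp_all add: contract_def card_less_insert insert_commute del: insert_iff, simp_all)
qed

lemma contract_add: "contract v (\<lambda>\<sigma>. a \<sigma> + b \<sigma>) \<sigma> = contract v a \<sigma> + contract v b \<sigma>"
  by (simp add: contract_def algebra_simps)

lemma contract_zero: "contract v (\<lambda>_. 0) = (\<lambda>_. 0)"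
  by (rule ext) (simp add: contract_def)

lemma contract_diff: "contract v (\<lambda>\<sigma>. a \<sigma> - b \<sigma>) \<sigma> = contract v a \<sigma> - contract v b \<sigma>"
  by (simp add: contract_def algebra_simps)

lemma contract_uminus: "contract v (\<lambda>\<sigma>. - a \<sigma>) \<sigma> = - contract v a \<sigma>"
  by (simp add: contract_def)

lemma contract_scale: "contract v (\<lambda>\<sigma>. k * a \<sigma>) \<sigma> = k * contract v a \<sigma>"
  by (simp add: contract_def)

lemma boundary_add: "boundary X (\<lambda>\<sigma>. a \<sigma> + b \<sigma>) \<sigma> = boundary X a \<sigma> + boundary X b \<sigma>"
  by (simp add: boundary_def contract_add sum.distrib)

lemma boundary_diff: "boundary X (\<lambda>\<sigma>. a \<sigma> - b \<sigma>) \<sigma> = boundary X a \<sigma> - boundary X b \<sigma>"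
  by (simp add: boundary_def contract_diff sum_subtractf)

lemma boundary_uminus: "boundary X (\<lambda>\<sigma>. - a \<sigma>) \<sigma> = - boundary X a \<sigma>"
  by (simp add: boundary_def contract_uminus sum_negf)

lemma boundary_scale: "boundary X (\<lambda>\<sigma>. k * a \<sigma>) \<sigma> = k * boundary X a \<sigma>"
  by (simp add: boundary_def contract_scale sum_distrib_left)

lemma contract_sum: "contract v (\<lambda>\<sigma>. \<Sum>w\<in>X. f w \<sigma>) \<sigma> = (\<Sum>w\<in>X. contract v (f w) \<sigma>)"
  by (simp add: contract_def sum_distrib_left)

lemma contract_boundary: "contract v (boundary X c) \<sigma> = - boundary X (contract v c) \<sigma>"
proof -
  have "contract v (boundary X c) \<sigma> = (\<Sum>w\<in>X. contract v (contract w c) \<sigma>)"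
    unfolding boundary_def by (rule contract_sum)
  also have "\<dots> = - boundary X (contract v c) \<sigma>"
    by (subst contract_anticommute) (simp add: boundary_def sum_negf)
  finally show ?thesis .
qed

lemma contract_contract: "contract v (contract v c) \<sigma> = 0"
  by (simp add: contract_def)

text \<open>Splitting off one vertex \<open>v\<close>, the square of
  \<open>contract v + boundary X\<close> consists of two squares, which vanish, and two mixed terms,
  which cancel by anticommutation.\<close>

lemma boundary_boundary:
  assumes "finite X"
  shows "boundary X (boundary X c) \<sigma> = 0"
  using assms
proof (induction X arbitrary: \<sigma> rule: finite_induct)
  case empty
  then show ?case by (simp add: boundary_def)
next
  case (insert v X)
  have eq: "boundary (insert v X) b = (\<lambda>\<sigma>. contract v b \<sigma> + boundary X b \<sigma>)" for b :: "nat set \<Rightarrow> 'a"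
    using insert.hyps by (simp add: boundary_def)
  show ?case
    by (simp add: eq contract_add boundary_add insert.IH contract_contract contract_boundary)
qed

section \<open>Chain spaces, subcomplexes and links\<close>

lemma size_chainsI:
  "(\<And>\<sigma>. c \<sigma> \<noteq> 0 \<Longrightarrow> \<sigma> \<in> \<Delta> \<and> card \<sigma> = s) \<Longrightarrow> c \<in> size_chains \<Delta> s"
  by (simp add: size_chains_def)

lemma size_chainsD:
  "c \<in> size_chains \<Delta> s \<Longrightarrow> c \<sigma> \<noteq> 0 \<Longrightarrow> \<sigma> \<in> \<Delta> \<and> card \<sigma> = s"
  by (simp add: size_chains_def)

lemma size_chains_mono: "\<Delta> \<subseteq> \<Delta>' \<Longrightarrow> size_chains \<Delta> s \<subseteq> size_chains \<Delta>' s"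
  by (auto simp: size_chains_def)

lemma size_chains_add:
  "a \<in> size_chains \<Delta> s \<Longrightarrow> b \<in> size_chains \<Delta> s \<Longrightarrow> (\<lambda>\<sigma>. a \<sigma> + b \<sigma>) \<in> size_chains \<Delta> s"
  by (rule size_chainsI) (metis add.right_neutral size_chainsD)

lemma size_chains_uminus:
  "a \<in> size_chains \<Delta> s \<Longrightarrow> (\<lambda>\<sigma>. - a \<sigma>) \<in> size_chains \<Delta> s"
  by (simp add: size_chains_def)

lemma size_chains_diff:
  "a \<in> size_chains \<Delta> s \<Longrightarrow> b \<in> size_chains \<Delta> s \<Longrightarrow> (\<lambda>\<sigma>. a \<sigma> - b \<sigma>) \<in> size_chains \<Delta> s"
  using size_chains_add[of a \<Delta> s "\<lambda>\<sigma>. - b \<sigma>"] by (simp add: size_chains_uminus)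

lemma down_closed_finite: "down_closed \<Delta> \<Longrightarrow> \<sigma> \<in> \<Delta> \<Longrightarrow> finite \<sigma>"
  by (simp add: down_closed_def)

lemma down_closed_subset: "down_closed \<Delta> \<Longrightarrow> \<sigma> \<in> \<Delta> \<Longrightarrow> \<tau> \<subseteq> \<sigma> \<Longrightarrow> \<tau> \<in> \<Delta>"
  by (simp add: down_closed_def)

lemma down_closed_induced: "down_closed \<Delta> \<Longrightarrow> down_closed (induced \<Delta> W)"
  by (auto simp: down_closed_def induced_def)

lemma down_closed_link: "down_closed \<Delta> \<Longrightarrow> down_closed (link v \<Delta>)"
  unfolding down_closed_def link_def
  by (auto dest: finite_subset) (meson insert_mono)

lemma induced_link_subset: "down_closed \<Delta> \<Longrightarrow> induced (link v \<Delta>) W \<subseteq> induced \<Delta> W"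
  unfolding down_closed_def link_def induced_def by blast

text \<open>The faces of \<open>induced \<Delta> (insert v W)\<close> that contain \<open>v\<close>
  form a cone over the link, and contraction reads off the base of the cone. On chains this is the
  connecting map of the Mayer-Vietoris sequence.\<close>

lemma contract_chain:
  assumes "down_closed \<Delta>" "y \<in> size_chains (induced \<Delta> (insert v W)) (Suc s)" "v \<notin> W"
  shows "contract v y \<in> size_chains (induced (link v \<Delta>) W) s"
proof (rule size_chainsI)
  fix \<sigma> assume "contract v y \<sigma> \<noteq> 0"
  then have "v \<notin> \<sigma>" "y (insert v \<sigma>) \<noteq> 0"
    by (auto simp: contract_def split: if_splits)
  with size_chainsD[OF assms(2), of "insert v \<sigma>"] assms
  have "insert v \<sigma> \<in> \<Delta>" "insert v \<sigma> \<subseteq> insert v W" "card (insert v \<sigma>) = Suc s"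
    by (auto simp: induced_def)
  moreover have "finite \<sigma>" using assms(1) calculation(1) by (auto simp: down_closed_def)
  ultimately show "\<sigma> \<in> induced (link v \<Delta>) W \<and> card \<sigma> = s"
    using \<open>v \<notin> \<sigma>\<close> by (auto simp: induced_def link_def)
qed

lemma boundary_chain:
  assumes "down_closed \<Delta>" "c \<in> size_chains \<Delta> (Suc s)"
  shows "boundary X c \<in> size_chains \<Delta> s"
proof (rule size_chainsI)
  fix \<sigma> assume "boundary X c \<sigma> \<noteq> 0"
  then obtain v where "contract v c \<sigma> \<noteq> 0"
    unfolding boundary_def by (meson sum.not_neutral_contains_not_neutral)
  then have v: "v \<notin> \<sigma>" "c (insert v \<sigma>) \<noteq> 0" by (auto simp: contract_def split: if_splits)
  with size_chainsD[OF assms(2)] have *: "insert v \<sigma> \<in> \<Delta>" "card (insert v \<sigma>) = Suc s" by auto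
  then have "finite \<sigma>" "\<sigma> \<in> \<Delta>"
    using down_closed_finite[OF assms(1)] down_closed_subset[OF assms(1)] by auto
  then show "\<sigma> \<in> \<Delta> \<and> card \<sigma> = s" using * v by simp
qed

section \<open>Acyclicity and vertex links\<close>

definition exact_at :: "'k::field itself \<Rightarrow> nat set \<Rightarrow> nat set set \<Rightarrow> nat \<Rightarrow> bool" where
  "exact_at K X \<Delta> s \<longleftrightarrow>
     (\<forall>c \<in> size_chains \<Delta> s. boundary X c = (\<lambda>_. 0 :: 'k) \<longrightarrow>
        (\<exists>y \<in> size_chains \<Delta> (Suc s). boundary X y = c))"

lemma boundary_split:
  assumes "finite X" "v \<in> X"
  shows "boundary X c \<sigma> = contract v c \<sigma> + (\<Sum>w\<in>X-{v}. contract w c \<sigma>)"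
  using assms by (simp add: boundary_def sum.remove)

lemma contract_vanish:
  assumes "c \<in> size_chains (induced \<Delta> W) s" "v \<notin> W"
  shows "contract v c = (\<lambda>_. 0)"
proof
  fix \<sigma>
  show "contract v c \<sigma> = 0"
    using size_chainsD[OF assms(1), of "insert v \<sigma>"] assms(2) by (auto simp: contract_def induced_def)
qed

text \<open>The Mayer--Vietoris map from the homology of the link of \<open>v\<close> to that of \<open>\<Delta>[W]\<close> is onto
  when \<open>\<Delta>[W \<union> {v}]\<close> is acyclic in the relevant degree.\<close>
lemma not_exact_at_link:
  assumes dc: "down_closed \<Delta>" and X: "finite X" "v \<in> X" and v: "v \<notin> W"
    and nex: "\<not> exact_at K X (induced \<Delta> W) s"
    and ex: "exact_at K X (induced \<Delta> (insert v W)) s"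
  shows "\<not> exact_at K X (induced (link v \<Delta>) W) s"
proof
  assume exl: "exact_at K X (induced (link v \<Delta>) W) s"
  from nex obtain c :: "nat set \<Rightarrow> 'a" where c: "c \<in> size_chains (induced \<Delta> W) s"
    "boundary X c = (\<lambda>_. 0)" and nb: "\<And>y. y \<in> size_chains (induced \<Delta> W) (Suc s) \<Longrightarrow> boundary X y \<noteq> c"
    by (auto simp: exact_at_def)
  have "c \<in> size_chains (induced \<Delta> (insert v W)) s"
    using c(1) size_chains_mono[of "induced \<Delta> W" "induced \<Delta> (insert v W)"] by (auto simp: induced_def)
  with ex c(2) obtain y where y: "y \<in> size_chains (induced \<Delta> (insert v W)) (Suc s)" "boundary X y = c"
    by (auto simp: exact_at_def)
  \<comment> \<open>The cycle in the link that maps to the class of \<open>c\<close>: contraction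
    anticommutes with the boundary and kills \<open>c\<close>, which avoids
    \<open>v\<close>.\<close>
  define p where "p = contract v y"
  have p: "p \<in> size_chains (induced (link v \<Delta>) W) s"
    unfolding p_def using contract_chain[OF dc y(1) v] .
  have "boundary X p = (\<lambda>_. 0)"
  proof
    fix \<sigma>
    have "boundary X p \<sigma> = - contract v c \<sigma>"
      unfolding p_def using contract_boundary[of v X y \<sigma>] y(2) by simp
    then show "boundary X p \<sigma> = 0" using contract_vanish[OF c(1) v] by simp
  qed
  with exl p obtain z where z: "z \<in> size_chains (induced (link v \<Delta>) W) (Suc s)" "boundary X z = p"
    by (auto simp: exact_at_def)
  \<comment> \<open>The part of \<open>y\<close> avoiding \<open>v\<close> has boundary
    \<open>c - p\<close>. If \<open>p\<close> bounded \<open>z\<close> in the link, then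
    \<open>z + y0\<close> would fill \<open>c\<close> inside \<open>W\<close>.\<close>
  define y0 where "y0 = (\<lambda>\<sigma>. if v \<in> \<sigma> then 0 else y \<sigma>)"
  have y0: "y0 \<in> size_chains (induced \<Delta> W) (Suc s)"
  proof (rule size_chainsI)
    fix \<sigma> assume "y0 \<sigma> \<noteq> 0"
    then show "\<sigma> \<in> induced \<Delta> W \<and> card \<sigma> = Suc s"
      using size_chainsD[OF y(1), of \<sigma>] by (auto simp: y0_def induced_def split: if_splits)
  qed
  have z': "z \<in> size_chains (induced \<Delta> W) (Suc s)"
    using z(1) size_chains_mono[OF induced_link_subset[OF dc]] by blast
  have "boundary X (\<lambda>\<sigma>. z \<sigma> + y0 \<sigma>) = c"
  proof
    fix \<sigma>
    have "p \<sigma> + boundary X y0 \<sigma> = c \<sigma>"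
    proof (cases "v \<in> \<sigma>")
      case True
      then have "c \<sigma> = 0" using size_chainsD[OF c(1), of \<sigma>] v by (auto simp: induced_def)
      moreover have "p \<sigma> = 0" using True by (simp add: p_def contract_def)
      moreover have "boundary X y0 \<sigma> = 0"
        unfolding boundary_def by (rule sum.neutral) (use True in \<open>auto simp: contract_def y0_def\<close>)
      ultimately show ?thesis by simp
    next
      case False
      have "contract w y0 \<sigma> = contract w y \<sigma>" if "w \<noteq> v" for w
        using that False by (simp add: contract_def y0_def)
      moreover have "contract v y0 \<sigma> = 0" by (simp add: contract_def y0_def)
      ultimately show ?thesis
        using y(2) boundary_split[OF X, of y0 \<sigma>] boundary_split[OF X, of y \<sigma>]
        by (simp add: p_def)
    qed
    then show "boundary X (\<lambda>\<sigma>. z \<sigma> + y0 \<sigma>) \<sigma> = c \<sigma>" by (simp add: boundary_add z(2))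
  qed
  with nb size_chains_add[OF z' y0] show False by blast
qed

text \<open>A cycle \<open>p\<close> of the link bounds twice: some \<open>y\<close> avoiding
  \<open>v\<close>, and the cone \<open>k\<close> with apex \<open>v\<close>. The difference
  \<open>k - y\<close> is a cycle one size up; a filling \<open>w\<close> of it yields the filling
  \<open>- contract v w\<close> of \<open>p\<close> in the link.\<close>

lemma exact_at_link:
  fixes K :: "'k::field itself"
  assumes dc: "down_closed \<Delta>" and X: "finite X" "v \<in> X" and v: "v \<notin> U"
    and ex: "exact_at K X (induced \<Delta> U) r"
    and ex': "exact_at K X (induced \<Delta> (insert v U)) (Suc r)"
  shows "exact_at K X (induced (link v \<Delta>) U) r"
  unfolding exact_at_def
proof (intro ballI impI)
  fix p :: "nat set \<Rightarrow> 'k"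
  assume p: "p \<in> size_chains (induced (link v \<Delta>) U) r" and cyc: "boundary X p = (\<lambda>_. 0)"
  have "p \<in> size_chains (induced \<Delta> U) r"
    using p size_chains_mono[OF induced_link_subset[OF dc]] by blast
  with ex cyc obtain y where y: "y \<in> size_chains (induced \<Delta> U) (Suc r)" "boundary X y = p"
    by (auto simp: exact_at_def)
  \<comment> \<open>The cone over \<open>p\<close> with apex \<open>v\<close>; its sign is the one
    that \<open>contract v\<close> cancels.\<close>
  define k where "k = (\<lambda>\<sigma>. if v \<in> \<sigma> then (-1) ^ card {u\<in>\<sigma>-{v}. u < v} * p (\<sigma> - {v}) else 0)"
  have pv: "p \<sigma> = 0" if "v \<in> \<sigma>" for \<sigma>
    using size_chainsD[OF p, of \<sigma>] that by (auto simp: induced_def link_def)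
  have ck: "contract v k = p"
  proof
    fix \<sigma>
    show "contract v k \<sigma> = p \<sigma>"
    proof (cases "v \<in> \<sigma>")
      case True
      then show ?thesis by (simp add: contract_def pv)
    next
      case False
      then have "contract v k \<sigma> = (-1) ^ card {u\<in>\<sigma>. u < v} * ((-1) ^ card {u\<in>\<sigma>. u < v} * p \<sigma>)"
        by (simp add: contract_def k_def)
      also have "\<dots> = p \<sigma>"
        by (simp flip: mult.assoc power_add)
      finally show ?thesis .
    qed
  qed
  have k: "k \<in> size_chains (induced \<Delta> (insert v U)) (Suc r)"
  proof (rule size_chainsI)
    fix \<sigma> assume "k \<sigma> \<noteq> 0"
    then have \<sigma>: "v \<in> \<sigma>" "p (\<sigma> - {v}) \<noteq> 0" by (auto simp: k_def split: if_splits)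
    with size_chainsD[OF p, of "\<sigma> - {v}"]
    have *: "\<sigma> - {v} \<in> induced (link v \<Delta>) U" "card (\<sigma> - {v}) = r" by auto
    then have "\<sigma> \<in> \<Delta>" "\<sigma> \<subseteq> insert v U" using \<sigma>(1) by (auto simp: induced_def link_def insert_absorb)
    moreover have "finite \<sigma>" using calculation(1) dc by (auto simp: down_closed_def)
    then have "card \<sigma> = Suc r" using *(2) \<sigma>(1) by (metis card_Suc_Diff1)
    ultimately show "\<sigma> \<in> induced \<Delta> (insert v U) \<and> card \<sigma> = Suc r" by (auto simp: induced_def)
  qed
  \<comment> \<open>On faces containing \<open>v\<close> the boundary vanishes because
    \<open>p\<close> is a cycle; on the others only the summand of \<open>v\<close>
    survives.\<close>
  have bk: "boundary X k = p"
  proof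
    fix \<sigma>
    show "boundary X k \<sigma> = p \<sigma>"
    proof (cases "v \<in> \<sigma>")
      case True
      have "contract v (boundary X k) (\<sigma> - {v}) = 0"
        by (simp add: contract_boundary ck cyc)
      then have "boundary X k \<sigma> = 0"
        using True by (simp add: contract_def insert_absorb)
      then show ?thesis using True by (simp add: pv)
    next
      case False
      then have "contract w k \<sigma> = 0" if "w \<noteq> v" for w
        using that by (simp add: contract_def k_def)
      then show ?thesis using boundary_split[OF X, of k \<sigma>] ck by simp
    qed
  qed
  have y': "y \<in> size_chains (induced \<Delta> (insert v U)) (Suc r)"
    using y(1) size_chains_mono[of "induced \<Delta> U" "induced \<Delta> (insert v U)"] by (auto simp: induced_def)
  have "boundary X (\<lambda>\<sigma>. k \<sigma> - y \<sigma>) = (\<lambda>_. 0)"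
    by (rule ext) (simp add: boundary_diff bk y(2))
  with ex' size_chains_diff[OF k y'] obtain w where
    w: "w \<in> size_chains (induced \<Delta> (insert v U)) (Suc (Suc r))" "boundary X w = (\<lambda>\<sigma>. k \<sigma> - y \<sigma>)"
    by (auto simp: exact_at_def)
  have "boundary X (\<lambda>\<sigma>. - contract v w \<sigma>) = p"
  proof
    fix \<sigma>
    have "boundary X (\<lambda>\<sigma>. - contract v w \<sigma>) \<sigma> = contract v (boundary X w) \<sigma>"
      using contract_boundary[of v X w \<sigma>] boundary_uminus[of X "contract v w"] by simp
    also have "\<dots> = p \<sigma>"
      using contract_vanish[OF y(1) v] by (simp add: w(2) contract_diff ck)
    finally show "boundary X (\<lambda>\<sigma>. - contract v w \<sigma>) \<sigma> = p \<sigma>" .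
  qed
  moreover have "(\<lambda>\<sigma>. - contract v w \<sigma>) \<in> size_chains (induced (link v \<Delta>) U) (Suc r)"
    by (intro size_chains_uminus contract_chain[OF dc w(1) v])
  ultimately show "\<exists>y\<in>size_chains (induced (link v \<Delta>) U) (Suc r). boundary X y = p" by blast
qed

text \<open>Induction over the vertices of \<open>V\<close>, replacing the complex by the link of
  each in turn. Non-exactness over \<open>W\<close> and exactness over all larger
  \<open>W \<union> T\<close> both pass to the link. At the end a cycle that does not bound is
  non-zero, so some face has \<open>s\<close> vertices, and putting back the removed vertices adds
  \<open>card V\<close>.\<close>

lemma face_from_homology:
  fixes K :: "'k::field itself"
  assumes "finite V" "down_closed \<Delta>" "finite X" "V \<subseteq> X" "V \<inter> W = {}"
    and "\<not> exact_at K X (induced \<Delta> W) s"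
    and "\<And>T. T \<subseteq> V \<Longrightarrow> T \<noteq> {} \<Longrightarrow> exact_at K X (induced \<Delta> (W \<union> T)) (s + card T - 1)"
  shows "\<exists>\<sigma>\<in>\<Delta>. card \<sigma> = s + card V"
  using assms
proof (induction V arbitrary: \<Delta> rule: finite_induct)
  case empty
  then obtain c :: "nat set \<Rightarrow> 'k" where c: "c \<in> size_chains (induced \<Delta> W) s"
    and nb: "\<And>y. y \<in> size_chains (induced \<Delta> W) (Suc s) \<Longrightarrow> boundary X y \<noteq> c"
    by (auto simp: exact_at_def)
  have "(\<lambda>_. 0) \<in> size_chains (induced \<Delta> W) (Suc s)" by (rule size_chainsI) simp
  from nb[OF this] have "c \<noteq> (\<lambda>_. 0)" by (auto simp: boundary_def contract_zero)
  then obtain \<sigma> where "c \<sigma> \<noteq> 0" by auto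
  with size_chainsD[OF c] show ?case by (auto simp: induced_def)
next
  case (insert v V)
  have vW: "v \<notin> W" and vX: "v \<in> X" using insert.prems by auto
  \<comment> \<open>The exactness required here is the case \<open>T = {v}\<close>, where
    \<open>s + card T - 1\<close> is \<open>s\<close>.\<close>
  have "\<not> exact_at K X (induced (link v \<Delta>) W) s"
    using not_exact_at_link[OF insert.prems(1,2) vX vW insert.prems(5)] insert.prems(6)[of "{v}"]
    by simp
  \<comment> \<open>Exactness in the link over \<open>W \<union> T\<close> uses the hypothesis
    twice, for \<open>T\<close> and for \<open>insert v T\<close>, which lie in consecutive
    positions.\<close>
  moreover have "exact_at K X (induced (link v \<Delta>) (W \<union> T)) (s + card T - 1)"
    if T: "T \<subseteq> V" "T \<noteq> {}" for T
  proof (rule exact_at_link[OF insert.prems(1,2) vX])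
    have fT: "finite T" using T insert.hyps finite_subset by blast
    then have "card T > 0" using T by (simp add: card_gt_0_iff)
    moreover have "card (insert v T) = Suc (card T)" using fT T insert.hyps by (auto simp: card_insert_if)
    ultimately show "exact_at K X (induced \<Delta> (insert v (W \<union> T))) (Suc (s + card T - 1))"
      using insert.prems(6)[of "insert v T"] T by (auto simp: subset_insertI2)
    show "v \<notin> W \<union> T" using T insert.hyps vW by auto
    show "exact_at K X (induced \<Delta> (W \<union> T)) (s + card T - 1)"
      using insert.prems(6)[of T] T by auto
  qed
  ultimately obtain \<sigma> where \<sigma>: "\<sigma> \<in> link v \<Delta>" "card \<sigma> = s + card V"
    using insert.IH[OF down_closed_link[OF insert.prems(1)], of v] insert.prems by blast
  then have "insert v \<sigma> \<in> \<Delta>" "v \<notin> \<sigma>" by (auto simp: link_def)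
  moreover have "finite \<sigma>" using calculation(1) insert.prems(1) by (auto simp: down_closed_def)
  ultimately show ?case using \<sigma> insert.hyps by (intro bexI[of _ "insert v \<sigma>"]) auto
qed

section \<open>Betti numbers and the Euler characteristic\<close>

lemma (in vector_space) finite_dim_basis_extension:
  assumes "B \<subseteq> V" "independent B" "V \<subseteq> span F" "finite F"
  obtains C where "B \<subseteq> C" "C \<subseteq> V" "independent C" "V \<subseteq> span C" "finite C" "card C = dim V"
proof -
  obtain C where C: "B \<subseteq> C" "C \<subseteq> V" "independent C" "V \<subseteq> span C"
    using maximal_independent_subset_extend[OF assms(1,2)] by blast
  moreover have "finite C"
    using independent_span_bound[OF assms(4) C(3)] C(2) assms(3) by blast
  moreover have "card C = dim V" using basis_card_eq_dim C by blast
  ultimately show thesis using that by blast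
qed

text \<open>Extending a basis of \<open>B\<close> to one of \<open>Z\<close> adds nothing when the
  dimensions leave no room. Finiteness enters through the spanning set \<open>F\<close>, as the
  space of all functions on sets is infinite-dimensional.\<close>

lemma (in vector_space) finite_dim_subset_eq:
  assumes "subspace B" "B \<subseteq> Z" "Z \<subseteq> span F" "finite F" "dim Z \<le> dim B"
  shows "Z = B"
proof -
  obtain b where b: "b \<subseteq> B" "independent b" "B \<subseteq> span b" "card b = dim B"
    using basis_exists[of B] .
  then obtain c where c: "b \<subseteq> c" "c \<subseteq> Z" "Z \<subseteq> span c" "finite c" "card c = dim Z"
    using finite_dim_basis_extension[of b Z F] assms by (metis subset_trans)
  then have "b = c" using b assms(5) by (metis card_seteq)
  then show ?thesis using c b assms(1,2) by (metis span_minimal subset_antisym subset_trans)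
qed

lemma (in vector_space) finite_dim_subset_le:
  assumes "B \<subseteq> Z" "Z \<subseteq> span F" "finite F"
  shows "dim B \<le> dim Z"
proof -
  obtain b where b: "b \<subseteq> B" "independent b" "B \<subseteq> span b" "card b = dim B"
    using basis_exists[of B] .
  then obtain c where c: "b \<subseteq> c" "finite c" "card c = dim Z"
    using finite_dim_basis_extension[of b Z F] assms by (metis subset_trans)
  then show ?thesis using b by (metis card_mono)
qed

text \<open>A basis \<open>B\<close> of the kernel extends to a basis \<open>C\<close> of
  \<open>V\<close>, and \<open>f\<close> maps \<open>D = C - B\<close> injectively onto a basis of
  the image.\<close>

lemma (in vector_space) rank_nullity:
  assumes f: "Vector_Spaces.linear scale scale f" and V: "subspace V" "V \<subseteq> span F" "finite F"
  shows "dim V = dim {x\<in>V. f x = 0} + dim (f ` V)"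
proof -
  interpret p: vector_space_pair scale scale by unfold_locales
  interpret f: Vector_Spaces.linear scale scale f by fact
  let ?Z = "{x\<in>V. f x = 0}"
  obtain B where B: "B \<subseteq> ?Z" "independent B" "?Z \<subseteq> span B" "card B = dim ?Z"
    using basis_exists[of ?Z] .
  then obtain C where C: "B \<subseteq> C" "C \<subseteq> V" "independent C" "V \<subseteq> span C" "finite C" "card C = dim V"
    using finite_dim_basis_extension[of B V F] V by (smt (verit) mem_Collect_eq subset_iff)
  define D where "D = C - B"
  have indD: "independent D" using C(3) independent_mono[of C D] by (auto simp: D_def)
  have DV: "span D \<subseteq> V" using C(2) V(1) by (intro span_minimal) (auto simp: D_def)
  \<comment> \<open>Such an \<open>x\<close> lies in the spans of both \<open>B\<close> and
    \<open>D\<close>. Its unique representation over \<open>C\<close> is then supported on two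
    disjoint sets, hence zero.\<close>
  have ker: "x = 0" if x: "x \<in> span D" "f x = 0" for x
  proof -
    have "x \<in> span B" using x DV B(3) by blast
    then have rB: "representation C x = representation B x"
      using C representation_extend by blast
    have rD: "representation C x = representation D x"
      using C x representation_extend[of C x D] by (auto simp: D_def)
    have "representation C x b = 0" for b
      using representation_ne_zero[of B x b] representation_ne_zero[of D x b] rB rD
      by (auto simp: D_def)
    moreover have "x \<in> span C" using \<open>x \<in> span B\<close> C(1) span_mono by blast
    ultimately show "x = 0" using sum_nonzero_representation_eq[OF C(3), of x] by simp
  qed
  have inj: "inj_on f (span D)"
  proof (rule inj_onI)
    fix x y assume "x \<in> span D" "y \<in> span D" "f x = f y"
    then show "x = y" using ker[of "x - y"] by (simp add: span_diff f.diff)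
  qed
  then have injD: "inj_on f D" using inj_on_subset span_superset by blast
  have ind: "independent (f ` D)"
    using f.independent_inj_on_image[OF indD inj] .
  have "f ` V \<subseteq> span (f ` D)"
  proof
    fix z assume "z \<in> f ` V"
    then have "z \<in> span (f ` C)" using C(4) f.span_image[of C] by blast
    moreover have "f ` C \<subseteq> insert 0 (f ` D)" using B(1) by (auto simp: D_def)
    ultimately show "z \<in> span (f ` D)" using span_mono span_insert_0 by blast
  qed
  moreover have "f ` D \<subseteq> f ` V" using C(2) by (auto simp: D_def)
  ultimately have "dim (f ` V) = card D"
    using ind basis_card_eq_dim[of "f ` D"] card_image[OF injD] by simp
  moreover have "card C = card B + card D"
    using card_Diff_subset[of B C] card_mono[of C B] finite_subset[of B C] C by (simp add: D_def)
  ultimately show ?thesis using B C by simp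
qed

section \<open>Chain spaces as vector spaces\<close>

abbreviation (input) fscale :: "'k::field \<Rightarrow> (nat set \<Rightarrow> 'k) \<Rightarrow> nat set \<Rightarrow> 'k" where
  "fscale \<equiv> \<lambda>a f x. a * f x"

text \<open>The scaling is the very lambda term in \<open>rbetti\<close>, so \<open>fs.dim\<close>
  is the dimension used there.\<close>

interpretation fs: vector_space fscale
  by unfold_locales (auto simp: algebra_simps fun_eq_iff)

lemma sum_fun_apply: "(\<Sum>x\<in>A. f x) y = (\<Sum>x\<in>A. f x y)"
  by (induction A rule: infinite_finite_induct) auto

definition unit_chain :: "nat set \<Rightarrow> nat set \<Rightarrow> 'k::field" where
  "unit_chain \<sigma> = (\<lambda>\<tau>. if \<tau> = \<sigma> then 1 else 0)"

lemma inj_unit_chain: "inj (unit_chain :: _ \<Rightarrow> _ \<Rightarrow> 'k::field)"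
  by (rule injI) (metis unit_chain_def zero_neq_one)

lemma subspace_size_chains: "fs.subspace (size_chains \<Delta> s)"
proof (rule fs.subspaceI)
  fix x y :: "nat set \<Rightarrow> 'a" and a :: 'a
  assume x: "x \<in> size_chains \<Delta> s" and y: "y \<in> size_chains \<Delta> s"
  show "x + y \<in> size_chains \<Delta> s" using size_chains_add[OF x y] by (simp add: plus_fun_def)
  show "fscale a x \<in> size_chains \<Delta> s" using x by (simp add: size_chains_def)
qed (simp add: size_chains_def)

lemma size_chains_span:
  assumes "finite \<Delta>"
  shows "size_chains \<Delta> s \<subseteq> fs.span (unit_chain ` {\<sigma>\<in>\<Delta>. card \<sigma> = s})"
proof
  fix c :: "nat set \<Rightarrow> 'a" assume c: "c \<in> size_chains \<Delta> s"
  let ?F = "{\<sigma>\<in>\<Delta>. card \<sigma> = s}"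
  have "c = (\<Sum>\<sigma>\<in>?F. fscale (c \<sigma>) (unit_chain \<sigma>))"
  proof
    fix \<tau>
    have "(\<Sum>\<sigma>\<in>?F. fscale (c \<sigma>) (unit_chain \<sigma>)) \<tau> = (\<Sum>\<sigma>\<in>?F. if \<tau> = \<sigma> then c \<sigma> else 0)"
      unfolding sum_fun_apply by (rule sum.cong) (auto simp: unit_chain_def)
    also have "\<dots> = c \<tau>" using assms size_chainsD[OF c, of \<tau>] by (auto simp: sum.delta')
    finally show "c \<tau> = (\<Sum>\<sigma>\<in>?F. fscale (c \<sigma>) (unit_chain \<sigma>)) \<tau>" by simp
  qed
  also have "\<dots> \<in> fs.span (unit_chain ` ?F)"
    by (intro fs.span_sum fs.span_scale fs.span_base) auto
  finally show "c \<in> fs.span (unit_chain ` ?F)" .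
qed

lemma dim_size_chains:
  assumes "finite \<Delta>"
  shows "fs.dim (size_chains \<Delta> s :: (nat set \<Rightarrow> 'k::field) set) = card {\<sigma>\<in>\<Delta>. card \<sigma> = s}"
proof (rule fs.dim_unique)
  let ?F = "{\<sigma>\<in>\<Delta>. card \<sigma> = s}"
  have fin: "finite ?F" using assms by simp
  show "unit_chain ` ?F \<subseteq> (size_chains \<Delta> s :: (nat set \<Rightarrow> 'k) set)"
    by (auto simp: size_chains_def unit_chain_def split: if_splits)
  show "size_chains \<Delta> s \<subseteq> fs.span (unit_chain ` ?F)" by (rule size_chains_span[OF assms])
  show "card (unit_chain ` ?F :: (nat set \<Rightarrow> 'k) set) = card ?F"
    by (rule card_image) (rule inj_on_subset[OF inj_unit_chain], simp)
  show "fs.independent (unit_chain ` ?F :: (nat set \<Rightarrow> 'k) set)"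
  proof (rule fs.independent_if_scalars_zero)
    show "finite (unit_chain ` ?F)" using fin by simp
    fix g :: "(nat set \<Rightarrow> 'k) \<Rightarrow> 'k" and x :: "nat set \<Rightarrow> 'k"
    assume 0: "(\<Sum>x\<in>unit_chain ` ?F. fscale (g x) x) = 0" and x: "x \<in> unit_chain ` ?F"
    then obtain \<tau> where \<tau>: "\<tau> \<in> ?F" "x = unit_chain \<tau>" by blast
    have "0 = (\<Sum>x\<in>unit_chain ` ?F. fscale (g x) x) \<tau>" by (simp add: 0)
    also have "\<dots> = (\<Sum>\<sigma>\<in>?F. g (unit_chain \<sigma>) * unit_chain \<sigma> \<tau>)"
      unfolding sum_fun_apply by (subst sum.reindex) (auto intro: inj_on_subset[OF inj_unit_chain])
    also have "\<dots> = (\<Sum>\<sigma>\<in>?F. if \<tau> = \<sigma> then g (unit_chain \<sigma>) else 0)"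
      by (rule sum.cong) (auto simp: unit_chain_def)
    also have "\<dots> = g x" using \<tau> fin by (simp add: sum.delta')
    finally show "g x = 0" by simp
  qed
qed

lemma linear_boundary: "Vector_Spaces.linear fscale fscale (boundary X)"
  by unfold_locales (simp_all add: fun_eq_iff boundary_scale plus_fun_def boundary_add)

section \<open>Cycles, boundaries and reduced Betti numbers\<close>

definition cycles :: "nat set \<Rightarrow> nat set set \<Rightarrow> nat \<Rightarrow> (nat set \<Rightarrow> 'k::field) set" where
  "cycles X \<Delta> s = {c \<in> size_chains \<Delta> s. boundary X c = (\<lambda>_. 0)}"

lemma dim_chain_space:
  assumes "finite \<Delta>"
  shows "fs.dim (size_chains \<Delta> s :: (nat set \<Rightarrow> 'k::field) set) =
     fs.dim (cycles X \<Delta> s :: (nat set \<Rightarrow> 'k) set) + fs.dim (boundary X ` size_chains \<Delta> s :: (nat set \<Rightarrow> 'k) set)"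
  unfolding cycles_def zero_fun_def[symmetric]
  by (rule fs.rank_nullity[OF linear_boundary subspace_size_chains size_chains_span[OF assms]])
     (use assms in auto)

lemma boundaries_subset_cycles:
  assumes "down_closed \<Delta>" "finite X"
  shows "boundary X ` size_chains \<Delta> (Suc s) \<subseteq> cycles X \<Delta> s"
  using boundary_chain[OF assms(1)] boundary_boundary[OF assms(2)] by (auto simp: cycles_def fun_eq_iff)

text \<open>The extra vertices of \<open>X\<close> contribute nothing: a chain on
  \<open>\<Delta>\<close> vanishes on every set with a vertex outside
  \<open>\<Union>\<Delta>\<close>.\<close>

lemma bd_eq_boundary:
  assumes "c \<in> size_chains \<Delta> s" "\<Union>\<Delta> \<subseteq> X" "finite X"
  shows "bd \<Delta> c = boundary X c"
proof
  fix \<sigma>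
  have "(\<Sum>v\<in>\<Union>\<Delta> - \<sigma>. (-1) ^ card {u\<in>\<sigma>. u < v} * c (insert v \<sigma>)) = (\<Sum>v\<in>X. contract v c \<sigma>)"
  proof (rule sum.mono_neutral_cong_left)
    show "\<forall>v\<in>X - (\<Union>\<Delta> - \<sigma>). contract v c \<sigma> = 0"
    proof
      fix v assume v: "v \<in> X - (\<Union>\<Delta> - \<sigma>)"
      have "c (insert v \<sigma>) = 0" if "v \<notin> \<sigma>"
        using size_chainsD[OF assms(1), of "insert v \<sigma>"] v that by blast
      then show "contract v c \<sigma> = 0" by (simp add: contract_def)
    qed
    show "\<Union>\<Delta> - \<sigma> \<subseteq> X" using assms(2) by blast
  qed (simp_all add: assms(3) contract_def)
  then show "bd \<Delta> c \<sigma> = boundary X c \<sigma>" by (simp add: bd_def boundary_def)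
qed

lemma rbetti_size:
  fixes K :: "'k::field itself"
  assumes "\<Union>\<Delta> \<subseteq> X" "finite X" "q = int s - 1"
  shows "rbetti K \<Delta> q = fs.dim (cycles X \<Delta> s :: (nat set \<Rightarrow> 'k) set)
           - fs.dim (boundary X ` size_chains \<Delta> (Suc s) :: (nat set \<Rightarrow> 'k) set)"
proof -
  have 1: "chains K \<Delta> q = size_chains \<Delta> s" "chains K \<Delta> (q + 1) = size_chains \<Delta> (Suc s)"
    using assms(3) by (auto simp: chains_def size_chains_def)
  have 2: "bd \<Delta> ` size_chains \<Delta> (Suc s) = boundary X ` (size_chains \<Delta> (Suc s) :: (nat set \<Rightarrow> 'k) set)"
    using bd_eq_boundary assms by (intro image_cong) auto
  have 3: "{c \<in> size_chains \<Delta> s. bd \<Delta> c = (\<lambda>_. 0)} = (cycles X \<Delta> s :: (nat set \<Rightarrow> 'k) set)"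
    unfolding cycles_def by (rule Collect_cong) (metis bd_eq_boundary[OF _ assms(1,2)])
  show ?thesis unfolding rbetti_def 1 2 3 ..
qed

text \<open>No face has a negative number of vertices, so only the zero chain remains.\<close>

lemma rbetti_neg:
  fixes K :: "'k::field itself"
  assumes "q < -1"
  shows "rbetti K \<Delta> q = 0"
proof -
  have "{c \<in> chains K \<Delta> q. bd \<Delta> c = (\<lambda>_. 0)} \<subseteq> fs.span {}"
    using assms by (auto simp: chains_def fun_eq_iff)
  from fs.dim_le_card[OF this] show ?thesis by (simp add: rbetti_def)
qed

locale finite_complex =
  fixes \<Delta> :: "nat set set" and X :: "nat set"
  assumes finite_vertices: "finite X" and faces_subset: "\<Union>\<Delta> \<subseteq> X" and down_closed: "down_closed \<Delta>"
begin

lemma finite_faces: "finite \<Delta>"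
  by (rule finite_subset[of _ "Pow X"]) (use finite_vertices faces_subset in auto)

text \<open>The truncated difference of dimensions vanishes iff the dimension of the cycles is at
  most that of the boundaries. As the boundaries form a subspace of the cycles, this forces
  equality.\<close>

lemma rbetti_eq_0_iff_exact_at:
  fixes K :: "'k::field itself"
  shows "rbetti K \<Delta> (int s - 1) = 0 \<longleftrightarrow> exact_at K X \<Delta> s"
proof -
  let ?Z = "cycles X \<Delta> s :: (nat set \<Rightarrow> 'k) set"
  let ?B = "boundary X ` size_chains \<Delta> (Suc s) :: (nat set \<Rightarrow> 'k) set"
  have sub: "fs.subspace ?B"
  proof -
    interpret Vector_Spaces.linear fscale fscale "boundary X :: _ \<Rightarrow> _ \<Rightarrow> 'k" by (rule linear_boundary)
    show ?thesis by (rule subspace_image[OF subspace_size_chains])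
  qed
  have BZ: "?B \<subseteq> ?Z" by (rule boundaries_subset_cycles[OF down_closed finite_vertices])
  have Zs: "?Z \<subseteq> fs.span (unit_chain ` {\<sigma>\<in>\<Delta>. card \<sigma> = s})"
    using size_chains_span[OF finite_faces] by (auto simp: cycles_def)
  have "rbetti K \<Delta> (int s - 1) = 0 \<longleftrightarrow> fs.dim ?Z \<le> fs.dim ?B"
    using rbetti_size[OF faces_subset finite_vertices, of "int s - 1" s K] by simp
  also have "\<dots> \<longleftrightarrow> ?Z = ?B"
    using fs.finite_dim_subset_eq[OF sub BZ Zs] finite_faces by auto
  also have "\<dots> \<longleftrightarrow> exact_at K X \<Delta> s"
  proof
    assume "?Z = ?B"
    show "exact_at K X \<Delta> s"
      unfolding exact_at_def
    proof (intro ballI impI)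
      fix c :: "nat set \<Rightarrow> 'k" assume "c \<in> size_chains \<Delta> s" "boundary X c = (\<lambda>_. 0)"
      then have "c \<in> ?Z" by (simp add: cycles_def)
      with \<open>?Z = ?B\<close> have "c \<in> ?B" by simp
      then show "\<exists>y\<in>size_chains \<Delta> (Suc s). boundary X y = c" by blast
    qed
  next
    assume "exact_at K X \<Delta> s"
    then have "?Z \<subseteq> ?B" unfolding exact_at_def cycles_def by blast
    with BZ show "?Z = ?B" by blast
  qed
  finally show ?thesis .
qed

text \<open>Rank-nullity writes the face numbers as \<open>z s + b s\<close>, and the Betti numbers
  are \<open>z s - b (Suc s)\<close>; the alternating sums differ only by end terms, which
  vanish.\<close>

lemma euler_poincare:
  fixes K :: "'k::field itself"
  assumes "\<And>\<sigma>. \<sigma> \<in> \<Delta> \<Longrightarrow> card \<sigma> \<le> N"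
  shows "(\<Sum>s\<le>N. (-1) ^ s * real (rbetti K \<Delta> (int s - 1)))
       = (\<Sum>s\<le>N. (-1) ^ s * real (card {\<sigma>\<in>\<Delta>. card \<sigma> = s}))"
proof -
  define z where "z s = real (fs.dim (cycles X \<Delta> s :: (nat set \<Rightarrow> 'k) set))" for s
  define b where "b s = real (fs.dim (boundary X ` size_chains \<Delta> s :: (nat set \<Rightarrow> 'k) set))" for s
  \<comment> \<open>Boundaries are cycles, so the natural subtraction in \<open>rbetti\<close> does
    not truncate.\<close>
  have rb: "real (rbetti K \<Delta> (int s - 1)) = z s - b (Suc s)" for s
  proof -
    have "fs.dim (boundary X ` size_chains \<Delta> (Suc s) :: (nat set \<Rightarrow> 'k) set) \<le>
        fs.dim (cycles X \<Delta> s :: (nat set \<Rightarrow> 'k) set)"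
    proof (rule fs.finite_dim_subset_le)
      show "cycles X \<Delta> s \<subseteq> fs.span (unit_chain ` {\<sigma>\<in>\<Delta>. card \<sigma> = s} :: (nat set \<Rightarrow> 'k) set)"
        using size_chains_span[OF finite_faces] by (auto simp: cycles_def)
    qed (simp_all add: boundaries_subset_cycles[OF down_closed finite_vertices] finite_faces)
    then show ?thesis
      using rbetti_size[OF faces_subset finite_vertices, of "int s - 1" s K]
      by (simp add: z_def b_def)
  qed
  have ch: "real (card {\<sigma>\<in>\<Delta>. card \<sigma> = s}) = z s + b s" for s
    unfolding z_def b_def dim_size_chains[OF finite_faces, symmetric, where 'k = 'k]
    by (simp add: dim_chain_space[OF finite_faces, of s X])
  have b0: "b s = 0" if "s = 0 \<or> s = Suc N" for s
  proof -
    have "boundary X ` size_chains \<Delta> s \<subseteq> (fs.span {} :: (nat set \<Rightarrow> 'k) set)"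
    proof (clarsimp simp: fun_eq_iff)
      fix c :: "nat set \<Rightarrow> 'k" and \<sigma> assume c: "c \<in> size_chains \<Delta> s"
      have "contract v c \<sigma> = 0" for v
      proof -
        have "c (insert v \<sigma>) = 0"
        proof (rule ccontr)
          assume "c (insert v \<sigma>) \<noteq> 0"
          with size_chainsD[OF c] have *: "insert v \<sigma> \<in> \<Delta>" "card (insert v \<sigma>) = s" by auto
          have "finite (insert v \<sigma>)" by (rule down_closed_finite[OF down_closed *(1)])
          then have "card (insert v \<sigma>) > 0" by (simp add: card_gt_0_iff)
          with * that assms[of "insert v \<sigma>"] show False by linarith
        qed
        then show ?thesis by (simp add: contract_def)
      qed
      then show "boundary X c \<sigma> = 0" by (simp add: boundary_def)
    qed
    from fs.dim_le_card[OF this] show ?thesis by (simp add: b_def)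
  qed
  \<comment> \<open>Stated for every \<open>M\<close> to allow induction; at \<open>M = N\<close>
    both end terms are zero by \<open>b0\<close>.\<close>
  have "(\<Sum>s\<le>M. (-1) ^ s * (z s - b (Suc s))) = (\<Sum>s\<le>M. (-1) ^ s * (z s + b s)) + (-1) ^ Suc M * b (Suc M) - b 0" for M
    by (induction M) (auto simp: algebra_simps)
  from this[of N] show ?thesis by (simp add: rb ch b0)
qed

end

section \<open>Interpolation at the skips\<close>

text \<open>By its degree, \<open>p\<close> equals its interpolant \<open>q\<close> on the
  \<open>d + 1\<close> nodes. Every basis polynomial \<open>N x\<close> is monic of degree
  \<open>d\<close>, so the coefficient is the sum of the scaling factors.\<close>

lemma coeff_eq_lagrange:
  fixes p :: "'a::field poly"
  assumes X: "finite X" "card X = Suc d" and deg: "degree p \<le> d"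
  shows "coeff p d = (\<Sum>x\<in>X. poly p x / (\<Prod>y\<in>X-{x}. x - y))"
proof -
  define N where "N x = (\<Prod>y\<in>X-{x}. [:-y, 1:])" for x
  define q where "q = (\<Sum>x\<in>X. smult (poly p x / (\<Prod>y\<in>X-{x}. x - y)) (N x))"
  have degN: "degree (N x) = d" and coeffN: "coeff (N x) d = 1" if "x \<in> X" for x
  proof -
    have "degree (N x) = (\<Sum>y\<in>X-{x}. degree [:-y, 1:])"
      unfolding N_def by (rule degree_prod_eq_sum_degree) auto
    also have "\<dots> = d" using X that by simp
    finally show "degree (N x) = d" .
    moreover have "lead_coeff (N x) = 1" unfolding N_def by (simp add: lead_coeff_prod)
    ultimately show "coeff (N x) d = 1" by simp
  qed
  have polyN: "poly (N x) z = (if z = x then (\<Prod>y\<in>X-{x}. x - y) else 0)" if "x \<in> X" "z \<in> X" for x z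
    using X that by (auto simp: N_def poly_prod intro: prod_zero)
  have nz: "(\<Prod>y\<in>X-{x}. x - y) \<noteq> 0" for x using X by auto
  have "poly q z = poly p z" if "z \<in> X" for z
  proof -
    have "poly q z = (\<Sum>x\<in>X. if z = x then poly p x else 0)"
      unfolding q_def poly_sum using that nz by (intro sum.cong) (auto simp: polyN)
    then show ?thesis using that X by simp
  qed
  moreover have "degree q \<le> d"
    unfolding q_def using degN by (intro degree_sum_le X) (auto intro: order_trans[OF degree_smult_le])
  ultimately have "p = q"
    using deg X by (intro poly_eqI_degree[of X]) auto
  then have "coeff p d = coeff q d" by simp
  also have "\<dots> = (\<Sum>x\<in>X. poly p x / (\<Prod>y\<in>X-{x}. x - y))"
    unfolding q_def coeff_sum by (intro sum.cong) (auto simp: coeffN)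
  finally show ?thesis .
qed

section \<open>Binomial polynomials and the weights of the skips\<close>

definition binomial_poly :: "nat \<Rightarrow> real poly" where
  "binomial_poly s = smult (1 / fact s) (\<Prod>k<s. [:- real k, 1:])"

lemma poly_binomial_poly: "poly (binomial_poly s) (real m) = real (m choose s)"
  by (simp add: binomial_poly_def poly_prod binomial_gbinomial gbinomial_prod_rev atLeast0LessThan)

lemma degree_binomial_poly: "degree (binomial_poly s) = s"
proof -
  have "degree (\<Prod>k<s. [:- real k, 1:]) = (\<Sum>k<s. degree [:- real k, 1:])"
    by (rule degree_prod_eq_sum_degree) auto
  then show ?thesis by (simp add: binomial_poly_def)
qed

lemma lead_coeff_binomial_poly: "coeff (binomial_poly s) s = 1 / fact s"
proof -
  have "lead_coeff (binomial_poly s) = 1 / fact s"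
    unfolding binomial_poly_def lead_coeff_smult by (simp add: lead_coeff_prod)
  then show ?thesis by (simp add: degree_binomial_poly)
qed

text \<open>Up to sign, the Lagrange denominator of the node \<open>Q i\<close> among
  \<open>0\<close>, \<open>1\<close> and the \<open>Q u\<close>. The sign is determined in
  \<open>prod_diff_sign\<close>: a factor is negative exactly for the \<open>d - 1 - i\<close>
  indices above \<open>i\<close>.\<close>

definition node_weight :: "(nat \<Rightarrow> nat) \<Rightarrow> nat \<Rightarrow> nat \<Rightarrow> real" where
  "node_weight Q d i = real (Q i) * (real (Q i) - 1) * (\<Prod>u\<in>{1..d-1}-{i}. \<bar>real (Q i) - real (Q u)\<bar>)"

lemma prod_diff_sign:
  assumes strict: "\<And>u v. u < v \<Longrightarrow> v < d \<Longrightarrow> Q u < Q v" and i: "i \<in> {1..d-1}"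
  shows "(\<Prod>u\<in>{1..d-1}-{i}. real (Q i) - real (Q u))
     = (-1) ^ (d - 1 - i) * (\<Prod>u\<in>{1..d-1}-{i}. \<bar>real (Q i) - real (Q u)\<bar>)"
proof -
  have split: "{1..d-1}-{i} = {1..<i} \<union> {i<..d-1}" using i by auto
  have 1: "(\<Prod>u\<in>{1..<i}. \<bar>real (Q i) - real (Q u)\<bar>) = (\<Prod>u\<in>{1..<i}. real (Q i) - real (Q u))"
    using strict[of _ i] i by (intro prod.cong) (force dest: less_imp_le)+
  have "(\<Prod>u\<in>{i<..d-1}. real (Q i) - real (Q u)) = (\<Prod>u\<in>{i<..d-1}. (-1) * \<bar>real (Q i) - real (Q u)\<bar>)"
    using strict[of i] i by (intro prod.cong) (force dest: less_imp_le)+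
  then have 2: "(\<Prod>u\<in>{i<..d-1}. real (Q i) - real (Q u))
      = (-1) ^ (d - 1 - i) * (\<Prod>u\<in>{i<..d-1}. \<bar>real (Q i) - real (Q u)\<bar>)"
    unfolding prod.distrib by simp
  have U: "prod g ({1..<i} \<union> {i<..d-1}) = prod g {1..<i} * prod g {i<..d-1}" for g :: "nat \<Rightarrow> real"
    by (rule prod.union_disjoint) auto
  show ?thesis unfolding split U 1 2 by simp
qed

text \<open>\<open>P\<close> is a polynomial in \<open>m\<close> with coefficient
  \<open>a d / fact d\<close> at degree \<open>d\<close>, and Lagrange's formula evaluates this
  coefficient. The node \<open>0\<close> gives the first term, the node \<open>1\<close> drops out
  because \<open>P 1 = 0\<close>, and the skips give the sum.\<close>

lemma interpolation_at_skips:
  fixes a :: "nat \<Rightarrow> real" and Q :: "nat \<Rightarrow> nat" and d :: nat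
  defines "P \<equiv> \<lambda>m. \<Sum>s\<le>d. a s * real (m choose s)"
  assumes d: "1 \<le> d" and Q0: "Q 0 = 1" and strict: "\<And>u v. u < v \<Longrightarrow> v < d \<Longrightarrow> Q u < Q v"
    and P0: "P 0 = 1" and P1: "P 1 = 0"
  shows "(-1) ^ d * a d / fact d =
     1 / (\<Prod>u\<in>{1..d-1}. real (Q u)) - (\<Sum>i\<in>{1..d-1}. (-1) ^ i * P (Q i) / node_weight Q d i)"
proof -
  let ?U = "{1..d-1}"
  define p where "p = (\<Sum>s\<le>d. smult (a s) (binomial_poly s))"
  have poly_p: "poly p (real m) = P m" for m
    by (simp add: p_def P_def poly_sum poly_binomial_poly)
  have deg: "degree p \<le> d"
    unfolding p_def
    by (intro degree_sum_le) (auto intro: order_trans[OF degree_smult_le] simp: degree_binomial_poly)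
  have "coeff p d = (\<Sum>s\<le>d. a s * coeff (binomial_poly s) d)"
    by (simp add: p_def coeff_sum)
  also have "\<dots> = (\<Sum>s\<le>d. if s = d then a d / fact d else 0)"
    by (intro sum.cong) (auto simp: lead_coeff_binomial_poly coeff_eq_0 degree_binomial_poly)
  finally have coeff: "coeff p d = a d / fact d" by simp
  have Qgt: "Q u > 1" if "u \<in> ?U" for u using strict[of 0 u] that Q0 by auto
  have inj: "inj_on (\<lambda>u. real (Q u)) ?U"
  proof (rule linorder_inj_onI')
    fix u v assume "u \<in> ?U" "v \<in> ?U" "u < v"
    then have "Q u < Q v" using d by (intro strict) auto
    then show "real (Q u) \<noteq> real (Q v)" by simp
  qed
  define Y where "Y = (\<lambda>u. real (Q u)) ` ?U"
  \<comment> \<open>The node \<open>1\<close> is the skip \<open>Q 0\<close>; adding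
    \<open>0\<close> makes \<open>d + 1\<close> distinct nodes.\<close>
  define X where "X = insert 0 (insert 1 Y)"
  have Y01: "0 \<notin> Y" "1 \<notin> Y" using Qgt by (force simp: Y_def)+
  have finY: "finite Y" by (simp add: Y_def)
  have cardX: "card X = Suc d"
    using d Y01 finY card_image[OF inj] by (simp add: X_def Y_def)
  have t0: "(\<Prod>y\<in>X-{0}. 0 - y) = (-1) ^ d * (\<Prod>u\<in>?U. real (Q u))"
  proof -
    have "X - {0} = insert 1 Y" using Y01 by (auto simp: X_def)
    then have "(\<Prod>y\<in>X-{0}. 0 - y) = - (\<Prod>y\<in>Y. (-1) * y)" using Y01 finY by simp
    also have "\<dots> = - (\<Prod>u\<in>?U. (-1) * real (Q u))"
      unfolding Y_def by (subst prod.reindex[OF inj]) simp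
    also have "\<dots> = - ((-1) ^ (d - 1)) * (\<Prod>u\<in>?U. real (Q u))"
      unfolding prod.distrib by simp
    also have "- ((-1) ^ (d - 1)) = (-1 :: real) ^ d" using d by (cases d) auto
    finally show ?thesis .
  qed
  have ti: "(\<Prod>y\<in>X-{real (Q i)}. real (Q i) - y) = (-1) ^ (d - 1 - i) * node_weight Q d i" if i: "i \<in> ?U" for i
  proof -
    have "X - {real (Q i)} = insert 0 (insert 1 ((\<lambda>u. real (Q u)) ` (?U - {i})))"
      using Qgt[OF i] i inj by (auto simp: X_def Y_def inj_on_def)
    moreover have "0 \<notin> (\<lambda>u. real (Q u)) ` (?U - {i})" "1 \<notin> (\<lambda>u. real (Q u)) ` (?U - {i})"
      using Y01 by (auto simp: Y_def)
    ultimately have "(\<Prod>y\<in>X-{real (Q i)}. real (Q i) - y) = real (Q i) * (real (Q i) - 1) *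
        (\<Prod>y\<in>(\<lambda>u. real (Q u)) ` (?U - {i}). real (Q i) - y)"
      by simp
    also have "(\<Prod>y\<in>(\<lambda>u. real (Q u)) ` (?U - {i}). real (Q i) - y) = (\<Prod>u\<in>?U - {i}. real (Q i) - real (Q u))"
      by (subst prod.reindex) (auto intro: inj_on_subset[OF inj])
    also have "(\<Prod>u\<in>?U - {i}. real (Q i) - real (Q u)) =
        (-1) ^ (d - 1 - i) * (\<Prod>u\<in>?U - {i}. \<bar>real (Q i) - real (Q u)\<bar>)"
      by (rule prod_diff_sign) (use strict i in auto)
    finally show ?thesis by (simp add: node_weight_def mult_ac)
  qed
  have "a d / fact d = (\<Sum>x\<in>X. poly p x / (\<Prod>y\<in>X-{x}. x - y))"
    using coeff_eq_lagrange[OF _ cardX deg] finY coeff by (simp add: X_def)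
  also have "\<dots> = poly p 0 / (\<Prod>y\<in>X-{0}. 0 - y) + poly p 1 / (\<Prod>y\<in>X-{1}. 1 - y)
      + (\<Sum>x\<in>Y. poly p x / (\<Prod>y\<in>X-{x}. x - y))"
  proof -
    have "sum g X = g 0 + g 1 + sum g Y" for g :: "real \<Rightarrow> real"
      using Y01 finY by (simp add: X_def)
    then show ?thesis .
  qed
  also have "poly p 0 = 1" using poly_p[of 0] P0 by simp
  also have "poly p 1 = 0" using poly_p[of 1] P1 by simp
  also have "(\<Sum>x\<in>Y. poly p x / (\<Prod>y\<in>X-{x}. x - y)) = (\<Sum>i\<in>?U. P (Q i) / ((-1) ^ (d - 1 - i) * node_weight Q d i))"
    unfolding Y_def by (subst sum.reindex[OF inj]) (auto intro!: sum.cong simp: poly_p ti)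
  finally have "(-1) ^ d * (a d / fact d) = (-1) ^ d * (1 / ((-1) ^ d * (\<Prod>u\<in>?U. real (Q u)))
      + (\<Sum>i\<in>?U. P (Q i) / ((-1) ^ (d - 1 - i) * node_weight Q d i)))"
    unfolding t0 by simp
  also have "\<dots> = 1 / (\<Prod>u\<in>?U. real (Q u)) + (\<Sum>i\<in>?U. (-1) ^ d * (P (Q i) / ((-1) ^ (d - 1 - i) * node_weight Q d i)))"
    by (simp add: distrib_left sum_distrib_left)
  \<comment> \<open>The exponents \<open>d - 1 - i\<close> and \<open>i\<close> add up to
    \<open>d - 1\<close>, which leaves the sign \<open>(-1) ^ i\<close> and one minus.\<close>
  also have "(\<Sum>i\<in>?U. (-1) ^ d * (P (Q i) / ((-1) ^ (d - 1 - i) * node_weight Q d i)))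
      = (\<Sum>i\<in>?U. - ((-1) ^ i * P (Q i) / node_weight Q d i))"
  proof (rule sum.cong[OF refl])
    fix i assume i: "i \<in> ?U"
    then have "(-1 :: real) ^ d = - ((-1) ^ (d - 1 - i) * (-1) ^ i)"
      using d by (cases d) (auto simp flip: power_add)
    then show "(-1) ^ d * (P (Q i) / ((-1) ^ (d - 1 - i) * node_weight Q d i)) = - ((-1) ^ i * P (Q i) / node_weight Q d i)"
      by simp
  qed
  finally show ?thesis by (simp add: sum_negf)
qed

text \<open>\<open>ccoef\<close> omits from a product over all skips precisely the factors involving
  \<open>i\<close>, and \<open>node_weight\<close> supplies them. Hence the result does not depend
  on \<open>i\<close>: the coefficients \<open>ccoef\<close> clear the Lagrange
  denominators.\<close>

lemma ccoef_node_weight: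
  assumes strict: "\<And>u v. u < v \<Longrightarrow> v < d \<Longrightarrow> Q u < Q v" and i: "i \<in> {1..d-1}"
  shows "ccoef Q d i * node_weight Q d i =
    (\<Prod>u\<in>{1..d-1}. real (Q u) * (real (Q u) - 1)) *
    (\<Prod>(u,v)\<in>{(u,v). u \<in> {1..d-1} \<and> v \<in> {1..d-1} \<and> u < v}. real (Q v) - real (Q u))"
proof -
  let ?U = "{1..d-1}"
  let ?A = "{(u,v). u \<in> ?U - {i} \<and> v \<in> ?U - {i} \<and> u < v}"
  \<comment> \<open>The pair formed by \<open>u\<close> and \<open>i\<close> in increasing order, to
    enumerate the pairs that involve \<open>i\<close>.\<close>
  define h where "h u = (if u < i then (u, i) else (i, u))" for u
  have injh: "inj_on h (?U - {i})" by (auto simp: inj_on_def h_def split: if_splits)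
  have split: "{(u,v). u \<in> ?U \<and> v \<in> ?U \<and> u < v} = ?A \<union> h ` (?U - {i})"
    using i by (auto simp: h_def image_iff split: if_splits)
  have disj: "?A \<inter> h ` (?U - {i}) = {}" by (auto simp: h_def split: if_splits)
  have finA: "finite ?A" by (rule finite_subset[of _ "?U \<times> ?U"]) auto
  have "(\<Prod>(u,v)\<in>h ` (?U - {i}). real (Q v) - real (Q u)) = (\<Prod>u\<in>?U-{i}. \<bar>real (Q i) - real (Q u)\<bar>)"
    unfolding prod.reindex[OF injh] comp_def
  proof (intro prod.cong refl)
    fix u assume "u \<in> ?U - {i}"
    then have "u < d" "i < d" "u < i \<or> i < u" using i by auto
    then show "(case h u of (u, v) \<Rightarrow> real (Q v) - real (Q u)) = \<bar>real (Q i) - real (Q u)\<bar>"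
      using strict[of u i] strict[of i u] by (auto simp: h_def)
  qed
  then have 2: "(\<Prod>(u,v)\<in>{(u,v). u \<in> ?U \<and> v \<in> ?U \<and> u < v}. real (Q v) - real (Q u))
    = (\<Prod>(u,v)\<in>?A. real (Q v) - real (Q u)) * (\<Prod>u\<in>?U-{i}. \<bar>real (Q i) - real (Q u)\<bar>)"
    unfolding split using finA disj by (subst prod.union_disjoint) auto
  have 1: "(\<Prod>u\<in>?U. real (Q u) * (real (Q u) - 1))
     = real (Q i) * (real (Q i) - 1) * (\<Prod>u\<in>?U-{i}. real (Q u) * (real (Q u) - 1))"
    using i by (subst prod.remove[of _ i]) auto
  show ?thesis unfolding 1 2 ccoef_def node_weight_def by (simp add: mult_ac)
qed

text \<open>Multiply the interpolation formula by the common value \<open>D > 0\<close> of all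
  \<open>ccoef Q d i * node_weight Q d i\<close>.\<close>

lemma skip_criterion:
  fixes a :: "nat \<Rightarrow> real" and Q :: "nat \<Rightarrow> nat" and d :: nat
  defines "P \<equiv> \<lambda>m. \<Sum>s\<le>d. a s * real (m choose s)"
  assumes d: "1 \<le> d" and Q0: "Q 0 = 1" and strict: "\<And>u v. u < v \<Longrightarrow> v < d \<Longrightarrow> Q u < Q v"
    and P0: "P 0 = 1" and P1: "P 1 = 0"
  shows "(-1) ^ d * a d / fact d \<le> 1 / (\<Prod>u\<in>{1..d-1}. real (Q u)) \<longleftrightarrow>
     (\<Sum>i=1..d-1. ccoef Q d i * ((-1) ^ i * P (Q i))) \<ge> 0"
proof -
  let ?U = "{1..d-1}"
  define D where "D = (\<Prod>u\<in>?U. real (Q u) * (real (Q u) - 1)) *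
    (\<Prod>(u,v)\<in>{(u,v). u \<in> ?U \<and> v \<in> ?U \<and> u < v}. real (Q v) - real (Q u))"
  have Qgt: "Q u > 1" if "u \<in> ?U" for u using strict[of 0 u] that Q0 by auto
  have "D > 0" unfolding D_def
  proof (intro mult_pos_pos prod_pos)
    fix u assume "u \<in> ?U"
    then have "1 < Q u" by (rule Qgt)
    then show "0 < real (Q u)" "0 < real (Q u) - 1" by auto
  qed (use strict in auto)
  have cw: "ccoef Q d i * node_weight Q d i = D" if "i \<in> ?U" for i
    unfolding D_def by (rule ccoef_node_weight) (use strict that in auto)
  have "(\<Sum>i=1..d-1. ccoef Q d i * ((-1) ^ i * P (Q i))) = D * (\<Sum>i\<in>?U. (-1) ^ i * P (Q i) / node_weight Q d i)"
    unfolding sum_distrib_left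
  proof (rule sum.cong[OF refl])
    fix i assume "i \<in> ?U"
    with cw[of i] \<open>D > 0\<close> have "node_weight Q d i \<noteq> 0" "D = ccoef Q d i * node_weight Q d i" by auto
    then show "ccoef Q d i * ((-1) ^ i * P (Q i)) = D * ((-1) ^ i * P (Q i) / node_weight Q d i)"
      by simp
  qed
  moreover have "(-1) ^ d * a d / fact d =
     1 / (\<Prod>u\<in>?U. real (Q u)) - (\<Sum>i\<in>?U. (-1) ^ i * P (Q i) / node_weight Q d i)"
    unfolding P_def by (rule interpolation_at_skips) (use d Q0 strict P0 P1 in \<open>auto simp: P_def\<close>)
  ultimately show ?thesis using \<open>D > 0\<close> by (simp add: zero_le_mult_iff)
qed

section \<open>Maximal shifts and upper skips\<close>

locale labelled_complex =
  fixes K :: "'k::field itself" and n d :: nat and \<Gamma> :: "nat set set"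
  assumes simplicial: "simplicial_complex n \<Gamma>" and d_eq: "d = Max (card ` \<Gamma>)"
begin

abbreviation "M \<equiv> Mshift K n \<Gamma>"
abbreviation "Q \<equiv> upper_skip K n d \<Gamma>"
abbreviation "\<beta> W \<equiv> rbetti K (induced \<Gamma> W)"

definition skips :: "nat set" where
  "skips = {1..n} - M ` {1..n - d}"

definition face_count :: "nat \<Rightarrow> nat" where
  "face_count s = card {\<sigma>\<in>\<Gamma>. card \<sigma> = s}"

text \<open>By Hochster's formula, the degrees of the generators in step \<open>i\<close> of the
  minimal resolution. Index \<open>0\<close> is kept as the start of the increasing chain.\<close>

definition shifts :: "nat \<Rightarrow> nat set" where
  "shifts i = {card W | W. W \<subseteq> {1..n} \<and> \<beta> W (int (card W) - int i - 1) \<noteq> 0}"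

lemma face_subset: "\<sigma> \<in> \<Gamma> \<Longrightarrow> \<sigma> \<subseteq> {1..n}"
  using simplicial by (auto simp: simplicial_complex_def)

lemma empty_face: "{} \<in> \<Gamma>"
  using simplicial by (auto simp: simplicial_complex_def)

lemma finite_face: "\<sigma> \<in> \<Gamma> \<Longrightarrow> finite \<sigma>"
  using face_subset finite_subset by blast

lemma finite_Gamma: "finite \<Gamma>"
  by (rule finite_subset[of _ "Pow {1..n}"]) (use face_subset in blast)+

lemma down_closed_complex: "down_closed \<Gamma>"
  unfolding down_closed_def
proof (intro ballI conjI allI impI)
  show "\<tau> \<in> \<Gamma>" if "\<sigma> \<in> \<Gamma>" "\<tau> \<subseteq> \<sigma>" for \<sigma> \<tau>
    using simplicial that unfolding simplicial_complex_def by meson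
qed (rule finite_face)

lemma card_face_le: "\<sigma> \<in> \<Gamma> \<Longrightarrow> card \<sigma> \<le> d"
  unfolding d_eq using finite_Gamma by simp

lemma dim_le: "d \<le> n"
proof -
  have "d \<in> card ` \<Gamma>" unfolding d_eq using finite_Gamma empty_face by (intro Max_in) auto
  then show ?thesis using card_mono[OF _ face_subset] by fastforce
qed

lemma finite_complex_induced: "finite_complex (induced \<Gamma> W) {1..n}"
  by unfold_locales
     (use face_subset down_closed_induced[OF down_closed_complex] in \<open>auto simp: induced_def\<close>)

section \<open>Strict growth of the maximal shifts\<close>

lemma betti_eq_0_iff: "\<beta> W (int s - 1) = 0 \<longleftrightarrow> exact_at K {1..n} (induced \<Gamma> W) s"
  using finite_complex.rbetti_eq_0_iff_exact_at[OF finite_complex_induced] .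

text \<open>If no larger set carried homology for \<open>Suc i\<close>, the hypotheses of
  \<open>face_from_homology\<close> would hold for \<open>W\<close> and its complement
  \<open>V\<close>.\<close>

lemma homology_extends:
  assumes W: "W \<subseteq> {1..n}" and i: "i < n - d" and nz: "\<beta> W (int (card W) - int i - 1) \<noteq> 0"
  shows "\<exists>W'. W \<subset> W' \<and> W' \<subseteq> {1..n} \<and> \<beta> W' (int (card W') - int (Suc i) - 1) \<noteq> 0"
proof (rule ccontr)
  assume none: "\<not> ?thesis"
  have finW: "finite W" using W finite_subset by blast
  \<comment> \<open>Non-zero homology has degree at least -1, so the natural subtraction in
    \<open>s\<close> is exact.\<close>
  have iW: "i \<le> card W"
    using rbetti_neg[of "int (card W) - int i - 1" K "induced \<Gamma> W"] nz by linarith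
  define s where "s = card W - i"
  define V where "V = {1..n} - W"
  have "\<exists>\<sigma>\<in>\<Gamma>. card \<sigma> = s + card V"
  proof (rule face_from_homology)
    have "int (card W) - int i - 1 = int s - 1" using iW by (simp add: s_def)
    then show "\<not> exact_at K {1..n} (induced \<Gamma> W) s" using nz betti_eq_0_iff[of W s] by simp
  next
    fix T assume T: "T \<subseteq> V" "T \<noteq> {}"
    then have "finite T" by (metis V_def finite_Diff finite_atLeastAtMost finite_subset)
    then have cT: "card T > 0" using T by (simp add: card_gt_0_iff)
    have cWT: "card (W \<union> T) = card W + card T"
      using T finW \<open>finite T\<close> by (intro card_Un_disjoint) (auto simp: V_def)
    have "W \<subset> W \<union> T" "W \<union> T \<subseteq> {1..n}" using T W by (auto simp: V_def)
    with none have "\<beta> (W \<union> T) (int (card (W \<union> T)) - int (Suc i) - 1) = 0" by blast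
    moreover have "int (card (W \<union> T)) - int (Suc i) - 1 = int (s + card T - 1) - 1"
      using cT cWT iW by (simp add: s_def)
    ultimately show "exact_at K {1..n} (induced \<Gamma> (W \<union> T)) (s + card T - 1)"
      using betti_eq_0_iff by metis
  qed (use down_closed_complex in \<open>auto simp: V_def\<close>)
  moreover have "card V = n - card W" using W finW by (simp add: V_def card_Diff_subset)
  moreover have "card W \<le> n" using card_mono[OF _ W] by simp
  \<comment> \<open>The face has \<open>s + card V = n - i > d\<close> vertices.\<close>
  ultimately show False using card_face_le i iW by (force simp: s_def)
qed

text \<open>The empty face is a cycle, and no vertex is available to bound it. This starts the chain
  of shifts.\<close>

lemma betti_empty: "\<beta> {} (-1) \<noteq> 0"
proof -
  have ind: "induced \<Gamma> {} = {{}}" using empty_face by (auto simp: induced_def)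
  have "\<not> exact_at K {1..n} (induced \<Gamma> {}) 0"
  proof
    assume ex: "exact_at K {1..n} (induced \<Gamma> {}) 0"
    have "unit_chain {} \<in> size_chains (induced \<Gamma> {}) 0"
      unfolding ind by (rule size_chainsI) (auto simp: unit_chain_def split: if_splits)
    moreover have "boundary {1..n} (unit_chain {}) = (\<lambda>_. 0 :: 'k)"
      by (rule ext) (auto simp: boundary_def contract_def unit_chain_def intro!: sum.neutral)
    ultimately obtain y :: "nat set \<Rightarrow> 'k" where y: "y \<in> size_chains (induced \<Gamma> {}) (Suc 0)"
      "boundary {1..n} y = unit_chain {}"
      using ex unfolding exact_at_def by blast
    have "y \<sigma> = 0" for \<sigma> using size_chainsD[OF y(1), of \<sigma>] unfolding ind by fastforce
    then have "boundary {1..n} y {} = 0" by (simp add: boundary_def contract_def)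
    with y(2) show False by (simp add: unit_chain_def)
  qed
  then show ?thesis using betti_eq_0_iff[of "{}" 0] by simp
qed

text \<open>The boundary of any vertex \<open>w\<close> is the empty face.\<close>

lemma betti_nonempty:
  assumes "W \<subseteq> {1..n}" "W \<noteq> {}"
  shows "\<beta> W (-1) = 0"
proof -
  obtain w where w: "w \<in> W" using assms by blast
  have "exact_at K {1..n} (induced \<Gamma> W) 0"
    unfolding exact_at_def
  proof (intro ballI impI)
    fix c :: "nat set \<Rightarrow> 'k" assume c: "c \<in> size_chains (induced \<Gamma> W) 0"
    have c0: "c \<sigma> = 0" if "\<sigma> \<noteq> {}" for \<sigma>
      using size_chainsD[OF c, of \<sigma>] that finite_face[of \<sigma>] by (auto simp: induced_def)
    define y where "y = (\<lambda>\<sigma>. if \<sigma> = {w} then c {} else 0)"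
    have "{w} \<in> \<Gamma>" using w assms simplicial by (auto simp: simplicial_complex_def)
    then have "y \<in> size_chains (induced \<Gamma> W) (Suc 0)"
      using w by (intro size_chainsI) (auto simp: y_def induced_def split: if_splits)
    moreover have "boundary {1..n} y = c"
    proof
      fix \<sigma>
      have "contract v y \<sigma> = (if v = w then if \<sigma> = {} then c {} else 0 else 0)" for v
        by (auto simp: contract_def y_def)
      then show "boundary {1..n} y \<sigma> = c \<sigma>"
        using w assms c0[of \<sigma>] by (auto simp: boundary_def)
    qed
    ultimately show "\<exists>y\<in>size_chains (induced \<Gamma> W) (Suc 0). boundary {1..n} y = c" by blast
  qed
  then show ?thesis using betti_eq_0_iff[of W 0] by simp
qed

text \<open>Only \<open>W\<close> itself can carry a coefficient, and the boundary has the same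
  coefficient up to sign at \<open>W - {w}\<close>; so a cycle is zero.\<close>

lemma betti_above_dimension:
  assumes W: "W \<subseteq> {1..n}" "W \<noteq> {}" and s: "card W \<le> s"
  shows "\<beta> W (int s - 1) = 0"
proof -
  have finW: "finite W" using W finite_subset by blast
  obtain w where w: "w \<in> W" using W by blast
  have "exact_at K {1..n} (induced \<Gamma> W) s"
    unfolding exact_at_def
  proof (intro ballI impI)
    fix c :: "nat set \<Rightarrow> 'k"
    assume c: "c \<in> size_chains (induced \<Gamma> W) s" and cyc: "boundary {1..n} c = (\<lambda>_. 0)"
    have cW: "\<sigma> = W" if "c \<sigma> \<noteq> 0" for \<sigma>
    proof -
      have "\<sigma> \<subseteq> W" "card \<sigma> = s" using size_chainsD[OF c that] by (auto simp: induced_def)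
      then show ?thesis using s finW by (metis card_seteq)
    qed
    have "contract v c (W - {w}) = (if v = w then (-1) ^ card {u\<in>W-{w}. u < w} * c W else 0)" for v
      using w cW[of "insert v (W - {w})"] by (auto simp: contract_def insert_absorb)
    then have "boundary {1..n} c (W - {w}) = (-1) ^ card {u\<in>W-{w}. u < w} * c W"
      using w W by (auto simp: boundary_def)
    then have "c W = 0" using cyc by simp
    then have "c = (\<lambda>_. 0)" using cW by auto
    moreover have "boundary {1..n} (\<lambda>_. 0 :: 'k) = (\<lambda>_. 0)"
      by (simp add: boundary_def contract_zero)
    moreover have "(\<lambda>_. 0 :: 'k) \<in> size_chains (induced \<Gamma> W) (Suc s)" by (rule size_chainsI) simp
    ultimately show "\<exists>y\<in>size_chains (induced \<Gamma> W) (Suc s). boundary {1..n} y = c" by blast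
  qed
  then show ?thesis using betti_eq_0_iff[of W s] by simp
qed

lemma Mshift_eq: "M i = Max (shifts i)"
  by (simp add: Mshift_def shifts_def)

lemma shiftsI: "W \<subseteq> {1..n} \<Longrightarrow> \<beta> W (int (card W) - int i - 1) \<noteq> 0 \<Longrightarrow> card W \<in> shifts i"
  by (auto simp: shifts_def)

lemma shiftsE:
  assumes "m \<in> shifts i"
  obtains W where "card W = m" "W \<subseteq> {1..n}" "\<beta> W (int (card W) - int i - 1) \<noteq> 0"
  using assms by (auto simp: shifts_def)

lemma shifts_subset: "shifts i \<subseteq> {..n}"
  using card_mono[of "{1..n}"] by (fastforce simp: shifts_def)

lemma finite_shifts: "finite (shifts i)"
  using shifts_subset finite_subset by blast

lemma shifts_step:
  assumes "i < n - d" "m \<in> shifts i"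
  shows "\<exists>m'\<in>shifts (Suc i). m < m'"
proof -
  obtain W where W: "card W = m" "W \<subseteq> {1..n}" "\<beta> W (int (card W) - int i - 1) \<noteq> 0"
    using assms(2) by (rule shiftsE)
  obtain W' where W': "W \<subset> W'" "W' \<subseteq> {1..n}" "\<beta> W' (int (card W') - int (Suc i) - 1) \<noteq> 0"
    using homology_extends[OF W(2) assms(1) W(3)] by blast
  have "card W < card W'" using W'(1,2) by (metis psubset_card_mono finite_atLeastAtMost finite_subset)
  then show ?thesis using shiftsI[OF W'(2,3)] W(1) by blast
qed

lemma shifts_nonempty: "i \<le> n - d \<Longrightarrow> shifts i \<noteq> {}"
proof (induction i)
  case 0
  then show ?case using shiftsI[of "{}" 0] betti_empty by auto
next
  case (Suc i)
  then show ?case using shifts_step[of i] by fastforce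
qed

lemma Mshift_step: "i < n - d \<Longrightarrow> M i < M (Suc i)"
proof -
  assume i: "i < n - d"
  then have "M i \<in> shifts i" unfolding Mshift_eq using finite_shifts shifts_nonempty by simp
  then obtain m' where "m' \<in> shifts (Suc i)" "M i < m'" using shifts_step i by blast
  then show "M i < M (Suc i)" unfolding Mshift_eq[of "Suc i"]
    using Max_ge[OF finite_shifts] by (meson less_le_trans)
qed

lemma Mshift_less: "i < j \<Longrightarrow> j \<le> n - d \<Longrightarrow> M i < M j"
proof (induction j)
  case (Suc j)
  then show ?case using Mshift_step[of j] by (cases "i = j") auto
qed simp

lemma Mshift_inj: "inj_on M {1..n - d}"
  by (rule linorder_inj_onI') (use Mshift_less in fastforce)

text \<open>Zero is excluded by \<open>M 0 < M i\<close>. A single vertex would contribute in degree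
  \<open>- i\<close>: for \<open>i = 1\<close> this is -1, where non-empty sets have no homology,
  and otherwise the degree is below -1.\<close>

lemma Mshift_range:
  assumes "1 \<le> i" "i \<le> n - d"
  shows "2 \<le> M i" "M i \<le> n"
proof -
  have Mi: "M i \<in> shifts i" unfolding Mshift_eq using finite_shifts shifts_nonempty assms by simp
  then show "M i \<le> n" using shifts_subset by blast
  have "M i \<noteq> 0" using Mshift_less[of 0 i] assms by simp
  moreover have "M i \<noteq> 1"
  proof
    assume "M i = 1"
    with Mi have "1 \<in> shifts i" by simp
    then obtain W where W: "card W = 1" "W \<subseteq> {1..n}" "\<beta> W (int (card W) - int i - 1) \<noteq> 0"
      by (rule shiftsE)
    show False
    proof (cases "i = 1")
      case True
      have "W \<noteq> {}" using W(1) by fastforce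
      then show False using True W betti_nonempty[of W] by simp
    next
      case False
      then show False using W assms rbetti_neg[of "int (card W) - int i - 1" K "induced \<Gamma> W"] by auto
    qed
  qed
  ultimately show "2 \<le> M i" by linarith
qed

section \<open>Upper skips and vanishing of Betti numbers\<close>

lemma finite_skips: "finite skips"
  by (simp add: skips_def)

lemma Mshift_image_subset: "M ` {1..n - d} \<subseteq> {1..n}"
  using Mshift_range by fastforce

lemma card_skips: "card skips = d"
proof -
  have "card skips = n - (n - d)"
    unfolding skips_def
    using card_Diff_subset[of "M ` {1..n - d}" "{1..n}"] Mshift_image_subset card_image[OF Mshift_inj]
    by simp
  then show ?thesis using dim_le by simp
qed

lemma upper_skip_eq: "Q k = sorted_list_of_set skips ! k"
  by (simp add: upper_skip_def skips_def)

lemma upper_skip_less: "u < v \<Longrightarrow> v < d \<Longrightarrow> Q u < Q v"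
  unfolding upper_skip_eq
  using sorted_wrt_nth_less[OF strict_sorted_list_of_set[of skips]] card_skips by simp

lemma upper_skip_image: "Q ` {..<d} = skips"
proof -
  have "Q ` {..<d} = (\<lambda>k. sorted_list_of_set skips ! k) ` {..<length (sorted_list_of_set skips)}"
    by (simp add: upper_skip_eq card_skips)
  also have "\<dots> = set (sorted_list_of_set skips)"
    by (auto simp: set_conv_nth)
  finally show ?thesis using finite_skips by simp
qed

lemma upper_skip_mem: "u < d \<Longrightarrow> Q u \<in> skips"
  using imageI[of u "{..<d}" Q] by (simp add: upper_skip_image)

lemma upper_skip_range: "u < d \<Longrightarrow> Q u \<in> {1..n}"
  using upper_skip_mem[of u] by (simp add: skips_def)

lemma skipsE:
  assumes "x \<in> skips"
  obtains u where "u < d" "Q u = x"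
  using assms unfolding upper_skip_image[symmetric] by auto

lemma upper_skip_inj: "inj_on Q {..<d}"
  by (rule linorder_inj_onI') (use upper_skip_less in fastforce)

lemma upper_skip_0:
  assumes "1 \<le> d"
  shows "Q 0 = 1"
proof -
  have "1 \<in> skips"
    using assms dim_le Mshift_range(1) by (force simp: skips_def)
  then obtain k where k: "k < d" "Q k = 1" by (rule skipsE)
  have "Q 0 \<ge> 1" using upper_skip_range[of 0] assms by simp
  then show ?thesis using k upper_skip_less[of 0 k] by (cases "k = 0") auto
qed

text \<open>The \<open>Q i - 1\<close> positive integers below \<open>Q i\<close> are the
  \<open>i\<close> earlier skips and the shifts among them.\<close>

lemma card_Mshift_below_skip:
  assumes "i < d"
  shows "card {k\<in>{1..n - d}. M k < Q i} + i + 1 = Q i"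
proof -
  let ?B = "{k\<in>{1..n - d}. M k < Q i}"
  have Qi: "Q i \<in> {1..n}" using upper_skip_range[OF assms] .
  have "{1..<Q i} = Q ` {..<i} \<union> M ` ?B"
  proof (intro equalityI subsetI)
    fix x assume x: "x \<in> {1..<Q i}"
    show "x \<in> Q ` {..<i} \<union> M ` ?B"
    proof (cases "x \<in> M ` {1..n - d}")
      case False
      with x Qi have "x \<in> skips" by (simp add: skips_def)
      then obtain u where u: "u < d" "Q u = x" by (rule skipsE)
      have "u < i"
        using u x assms upper_skip_less[of i u] by (cases "i < u"; cases "i = u") auto
      then show ?thesis using u(2) by auto
    qed (use x in auto)
  next
    fix x assume "x \<in> Q ` {..<i} \<union> M ` ?B"
    then show "x \<in> {1..<Q i}"
    proof
      assume "x \<in> Q ` {..<i}"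
      then obtain u where u: "u < i" "x = Q u" by auto
      then show ?thesis using upper_skip_range[of u] upper_skip_less[of u i] assms by simp
    qed (use Mshift_range(1) in force)
  qed
  moreover have "Q ` {..<i} \<inter> M ` ?B = {}"
  proof -
    have "Q ` {..<i} \<subseteq> skips"
      using image_mono[of "{..<i}" "{..<d}" Q] assms by (simp add: upper_skip_image)
    then show ?thesis unfolding skips_def by blast
  qed
  moreover have "card (Q ` {..<i}) = i"
    using assms by (subst card_image) (auto intro: inj_on_subset[OF upper_skip_inj])
  moreover have "card (M ` ?B) = card ?B"
    by (rule card_image) (auto intro: inj_on_subset[OF Mshift_inj])
  ultimately have "card {1..<Q i} = i + card ?B"
    by (simp add: card_Un_disjoint)
  moreover have "1 \<le> Q i" using Qi by simp
  ultimately show ?thesis by simp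
qed

text \<open>A non-zero class would put \<open>Q i\<close> into \<open>shifts k\<close> with
  \<open>k = Q i - 1 - j\<close>, so \<open>M k \<ge> Q i\<close> and, by monotonicity, fewer than
  \<open>k\<close> shifts lie below \<open>Q i\<close>. But their number is
  \<open>Q i - 1 - i\<close>, which is at least \<open>k\<close>.\<close>

lemma betti_vanishes_at_skip:
  assumes i: "i < d" and j: "i \<le> j" and W: "W \<subseteq> {1..n}" "card W = Q i"
  shows "\<beta> W (int j) = 0"
proof (rule ccontr)
  assume nz: "\<beta> W (int j) \<noteq> 0"
  let ?B = "{k\<in>{1..n - d}. M k < Q i}"
  have count: "card ?B + i + 1 = Q i" by (rule card_Mshift_below_skip[OF i])
  have "W \<noteq> {}" using count W(2) by auto
  have "j + 1 < Q i"
  proof (rule ccontr)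
    assume "\<not> j + 1 < Q i"
    then have "card W \<le> j + 1" using W(2) by simp
    then have "\<beta> W (int (j + 1) - 1) = 0" by (rule betti_above_dimension[OF W(1) \<open>W \<noteq> {}\<close>])
    then show False using nz by simp
  qed
  \<comment> \<open>Solves \<open>card W - k - 1 = j\<close>; the bound just shown makes the
    subtraction exact and \<open>k\<close> positive.\<close>
  define k where "k = Q i - 1 - j"
  have k: "1 \<le> k" "k \<le> card ?B" using \<open>j + 1 < Q i\<close> count j by (auto simp: k_def)
  have "card ?B \<le> card {1..n - d}" by (rule card_mono) auto
  then have kn: "k \<le> n - d" using k by simp
  have "int (card W) - int k - 1 = int j" using \<open>j + 1 < Q i\<close> W(2) by (simp add: k_def)
  then have "Q i \<in> shifts k" using shiftsI[OF W(1), of k] nz W(2) by simp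
  then have "Q i \<le> M k" unfolding Mshift_eq by (rule Max_ge[OF finite_shifts])
  have "?B \<subseteq> {1..<k}"
  proof
    fix l assume "l \<in> ?B"
    then have l: "1 \<le> l" "l \<le> n - d" "M l < Q i" by auto
    have "l < k"
    proof (rule ccontr)
      assume "\<not> l < k"
      then have "M k \<le> M l" using Mshift_less[of k l] l(2) by (cases "k = l") auto
      then show False using l(3) \<open>Q i \<le> M k\<close> by simp
    qed
    then show "l \<in> {1..<k}" using l(1) by simp
  qed
  then have "card ?B \<le> k - 1" using card_mono[of "{1..<k}" ?B] by simp
  then show False using k by simp
qed

section \<open>Averages over induced subcomplexes\<close>

lemma card_supersets:
  assumes \<sigma>: "\<sigma> \<subseteq> {1..n}" "card \<sigma> = s"
  shows "card {W. W \<subseteq> {1..n} \<and> card W = m \<and> \<sigma> \<subseteq> W} = (if s \<le> m then (n - s) choose (m - s) else 0)"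
proof (cases "s \<le> m")
  case True
  have fin: "finite \<sigma>" using \<sigma> finite_subset by blast
  have "bij_betw (\<lambda>T. T \<union> \<sigma>) {T. T \<subseteq> {1..n} - \<sigma> \<and> card T = m - s} {W. W \<subseteq> {1..n} \<and> card W = m \<and> \<sigma> \<subseteq> W}"
  proof (rule bij_betw_byWitness[where f' = "\<lambda>W. W - \<sigma>"])
    show "(\<lambda>T. T \<union> \<sigma>) ` {T. T \<subseteq> {1..n} - \<sigma> \<and> card T = m - s} \<subseteq> {W. W \<subseteq> {1..n} \<and> card W = m \<and> \<sigma> \<subseteq> W}"
    proof (rule image_subsetI)
      fix T assume "T \<in> {T. T \<subseteq> {1..n} - \<sigma> \<and> card T = m - s}"
      then have T: "T \<subseteq> {1..n} - \<sigma>" "card T = m - s" by auto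
      have "finite T" using T(1) by (rule finite_subset) simp
      then have "card (T \<union> \<sigma>) = card T + card \<sigma>" using T(1) fin by (intro card_Un_disjoint) auto
      then have "card (T \<union> \<sigma>) = m" using T(2) \<sigma>(2) True by simp
      then show "T \<union> \<sigma> \<in> {W. W \<subseteq> {1..n} \<and> card W = m \<and> \<sigma> \<subseteq> W}" using T(1) \<sigma>(1) by auto
    qed
    show "(\<lambda>W. W - \<sigma>) ` {W. W \<subseteq> {1..n} \<and> card W = m \<and> \<sigma> \<subseteq> W} \<subseteq> {T. T \<subseteq> {1..n} - \<sigma> \<and> card T = m - s}"
      using fin \<sigma>(2) by (auto simp: card_Diff_subset)
  qed auto
  then have "card {W. W \<subseteq> {1..n} \<and> card W = m \<and> \<sigma> \<subseteq> W} = card {T. T \<subseteq> {1..n} - \<sigma> \<and> card T = m - s}"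
    by (rule bij_betw_same_card[symmetric])
  also have "\<dots> = card ({1..n} - \<sigma>) choose (m - s)" by (rule n_subsets) simp
  also have "card ({1..n} - \<sigma>) = n - s" using \<sigma> fin by (simp add: card_Diff_subset)
  finally show ?thesis using True by simp
next
  case False
  have "\<not> \<sigma> \<subseteq> W" if "W \<subseteq> {1..n}" "card W = m" for W
    using card_mono[of W \<sigma>] that \<sigma> False finite_subset[of W "{1..n}"] by auto
  then have "{W. W \<subseteq> {1..n} \<and> card W = m \<and> \<sigma> \<subseteq> W} = {}" by blast
  then show ?thesis using False by simp
qed

text \<open>Double counting of the pairs \<open>\<sigma> \<subseteq> W\<close>. Moving the binomials
  around leaves \<open>m\<close> only in \<open>m choose s\<close>, which makes the average a
  polynomial in \<open>m\<close>.\<close>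

lemma average_face_count:
  assumes "s \<le> d" "m \<le> n"
  shows "(\<Sum>W\<in>{W. W \<subseteq> {1..n} \<and> card W = m}. real (card {\<sigma>\<in>induced \<Gamma> W. card \<sigma> = s})) / real (n choose m)
       = real (face_count s) / real (n choose s) * real (m choose s)"
proof -
  let ?WW = "{W. W \<subseteq> {1..n} \<and> card W = m}" and ?F = "{\<sigma>\<in>\<Gamma>. card \<sigma> = s}"
  have finW: "finite ?WW" by (rule finite_subset[of _ "Pow {1..n}"]) auto
  have finF: "finite ?F" using finite_Gamma by simp
  have "(\<Sum>W\<in>?WW. card {\<sigma>\<in>induced \<Gamma> W. card \<sigma> = s}) = (\<Sum>W\<in>?WW. \<Sum>\<sigma>\<in>?F. if \<sigma> \<subseteq> W then 1 else 0)"
  proof (rule sum.cong[OF refl])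
    fix W
    have "{\<sigma>\<in>induced \<Gamma> W. card \<sigma> = s} = {\<sigma>\<in>?F. \<sigma> \<subseteq> W}" by (auto simp: induced_def)
    then show "card {\<sigma>\<in>induced \<Gamma> W. card \<sigma> = s} = (\<Sum>\<sigma>\<in>?F. if \<sigma> \<subseteq> W then 1 else 0)"
      using finF by (simp flip: sum.inter_filter)
  qed
  also have "\<dots> = (\<Sum>\<sigma>\<in>?F. \<Sum>W\<in>?WW. if \<sigma> \<subseteq> W then 1 else 0)" by (rule sum.swap)
  also have "\<dots> = (\<Sum>\<sigma>\<in>?F. if s \<le> m then (n - s) choose (m - s) else 0)"
  proof (rule sum.cong[OF refl])
    fix \<sigma> assume "\<sigma> \<in> ?F"
    then have "card {W. W \<subseteq> {1..n} \<and> card W = m \<and> \<sigma> \<subseteq> W} = (if s \<le> m then (n - s) choose (m - s) else 0)"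
      using face_subset by (intro card_supersets) auto
    moreover have "{W\<in>?WW. \<sigma> \<subseteq> W} = {W. W \<subseteq> {1..n} \<and> card W = m \<and> \<sigma> \<subseteq> W}" by auto
    ultimately show "(\<Sum>W\<in>?WW. if \<sigma> \<subseteq> W then 1 else 0) = (if s \<le> m then (n - s) choose (m - s) else 0)"
      using finW by (simp flip: sum.inter_filter)
  qed
  also have "\<dots> = face_count s * (if s \<le> m then (n - s) choose (m - s) else 0)"
    by (simp add: face_count_def)
  finally have sum: "(\<Sum>W\<in>?WW. card {\<sigma>\<in>induced \<Gamma> W. card \<sigma> = s}) = face_count s * (if s \<le> m then (n - s) choose (m - s) else 0)" .
  have pos: "real (n choose m) > 0" "real (n choose s) > 0" using assms dim_le by simp_all
  have "real (if s \<le> m then (n - s) choose (m - s) else 0) * real (n choose s) = real (n choose m) * real (m choose s)"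
    using choose_mult[of s m n] assms by (simp flip: of_nat_mult)
  then have "real (if s \<le> m then (n - s) choose (m - s) else 0) / real (n choose m) = real (m choose s) / real (n choose s)"
    using pos by (simp add: field_simps del: of_nat_mult)
  moreover have "(\<Sum>W\<in>?WW. real (card {\<sigma>\<in>induced \<Gamma> W. card \<sigma> = s})) =
      real (face_count s) * real (if s \<le> m then (n - s) choose (m - s) else 0)"
    unfolding sum[unfolded of_nat_eq_iff[symmetric, where 'a = real]] of_nat_mult[symmetric] sum[symmetric] by simp
  ultimately show ?thesis by (metis times_divide_eq_left times_divide_eq_right)
qed

definition euler_coeff :: "nat \<Rightarrow> real" where
  "euler_coeff s = (-1) ^ s * real (face_count s) / real (n choose s)"

text \<open>For \<open>m \<le> n\<close>, the average of the negated reduced Euler characteristic,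
  since the sign counts vertices and not dimension.\<close>

definition euler_average :: "nat \<Rightarrow> real" where
  "euler_average m = (\<Sum>s\<le>d. euler_coeff s * real (m choose s))"

lemma euler_average_betti:
  assumes "m \<le> n"
  shows "euler_average m =
    (\<Sum>s\<le>d. (-1) ^ s * ((\<Sum>W\<in>{W. W \<subseteq> {1..n} \<and> card W = m}. real (\<beta> W (int s - 1))) / real (n choose m)))"
proof -
  let ?WW = "{W. W \<subseteq> {1..n} \<and> card W = m}"
  have "euler_average m = (\<Sum>s\<le>d. (-1) ^ s * ((\<Sum>W\<in>?WW. real (card {\<sigma>\<in>induced \<Gamma> W. card \<sigma> = s})) / real (n choose m)))"
    unfolding euler_average_def euler_coeff_def
  proof (rule sum.cong[OF refl])
    fix s assume "s \<in> {..d}"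
    then have s: "s \<le> d" by simp
    show "(-1) ^ s * real (face_count s) / real (n choose s) * real (m choose s)
        = (-1) ^ s * ((\<Sum>W\<in>?WW. real (card {\<sigma>\<in>induced \<Gamma> W. card \<sigma> = s})) / real (n choose m))"
      unfolding average_face_count[OF s assms] by simp
  qed
  also have "\<dots> = (\<Sum>W\<in>?WW. \<Sum>s\<le>d. (-1) ^ s * real (card {\<sigma>\<in>induced \<Gamma> W. card \<sigma> = s})) / real (n choose m)"
    by (subst sum.swap) (simp add: sum_divide_distrib sum_distrib_left)
  also have "\<dots> = (\<Sum>W\<in>?WW. \<Sum>s\<le>d. (-1) ^ s * real (\<beta> W (int s - 1))) / real (n choose m)"
    using finite_complex.euler_poincare[OF finite_complex_induced, of _ d K] card_face_le
    by (auto simp: induced_def)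
  also have "\<dots> = (\<Sum>s\<le>d. (-1) ^ s * ((\<Sum>W\<in>?WW. real (\<beta> W (int s - 1))) / real (n choose m)))"
    by (subst sum.swap) (simp add: sum_divide_distrib sum_distrib_left)
  finally show ?thesis .
qed

text \<open>In the Betti form of the average, the term of degree -1 vanishes on non-empty sets and
  the terms of degree at least \<open>i\<close> vanish at \<open>Q i\<close>; the degrees
  \<open>j < i\<close> remain.\<close>

lemma euler_average_skip:
  assumes i: "i \<in> {1..d-1}"
  shows "(-1) ^ i * euler_average (Q i) = (\<Sum>j=0..i-1. (-1) ^ (i - j - 1) * Aavg K n \<Gamma> j (Q i))"
proof -
  let ?WW = "{W. W \<subseteq> {1..n} \<and> card W = Q i}"
  have id: "i < d" using i by auto
  have Qi: "Q i \<in> {1..n}" using upper_skip_range[OF id] .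
  define T where "T s = (\<Sum>W\<in>?WW. real (\<beta> W (int s - 1))) / real (n choose Q i)" for s
  have "\<beta> W (-1) = 0" if "W \<in> ?WW" for W
    using that Qi by (intro betti_nonempty) auto
  then have T0: "T 0 = 0" by (simp add: T_def)
  have TS: "T (Suc j) = Aavg K n \<Gamma> j (Q i)" for j by (simp add: T_def Aavg_def)
  have Tv: "T (Suc j) = 0" if "i \<le> j" for j
    using betti_vanishes_at_skip[OF id that] by (simp add: T_def)
  have "euler_average (Q i) = (\<Sum>s\<le>d. (-1) ^ s * T s)"
    unfolding T_def using Qi by (intro euler_average_betti) simp
  also have "\<dots> = (\<Sum>s\<in>Suc ` {..<i}. (-1) ^ s * T s)"
  proof (rule sum.mono_neutral_right)
    show "\<forall>s\<in>{..d} - Suc ` {..<i}. (-1) ^ s * T s = 0"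
    proof
      fix s assume s: "s \<in> {..d} - Suc ` {..<i}"
      show "(-1) ^ s * T s = 0"
      proof (cases s)
        case 0
        then show ?thesis by (simp add: T0)
      next
        case (Suc j)
        then have "j \<notin> {..<i}" using s by blast
        then show ?thesis using Suc Tv[of j] by simp
      qed
    qed
  qed (use id in auto)
  also have "\<dots> = (\<Sum>j<i. (-1) ^ Suc j * Aavg K n \<Gamma> j (Q i))"
    by (subst sum.reindex) (simp_all add: TS)
  finally have "(-1) ^ i * euler_average (Q i) = (\<Sum>j<i. (-1) ^ i * ((-1) ^ Suc j * Aavg K n \<Gamma> j (Q i)))"
    by (simp add: sum_distrib_left)
  also have "\<dots> = (\<Sum>j<i. (-1) ^ (i - j - 1) * Aavg K n \<Gamma> j (Q i))"
  proof (rule sum.cong[OF refl])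
    fix j assume "j \<in> {..<i}"
    \<comment> \<open>The two exponents differ by an even number, and \<open>j < i\<close> keeps
      \<open>i - j - 1\<close> from truncating.\<close>
    then have "i + Suc j = (i - j - 1) + 2 * Suc j" by auto
    then have "(-1 :: real) ^ (i + Suc j) = (-1) ^ (i - j - 1) * (-1) ^ (2 * Suc j)"
      by (simp only: power_add)
    then have "(-1 :: real) ^ i * (-1) ^ Suc j = (-1) ^ (i - j - 1)"
      unfolding power_add[of "-1" i] power_mult by simp
    then show "(-1) ^ i * ((-1) ^ Suc j * Aavg K n \<Gamma> j (Q i)) = (-1) ^ (i - j - 1) * Aavg K n \<Gamma> j (Q i)"
      by (simp only: mult.assoc[symmetric])
  qed
  also have "{..<i} = {0..i-1}" using i by auto
  finally show ?thesis .
qed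

section \<open>Normalisation at 0 and 1, the product identity and the criterion\<close>

lemma face_count_0: "face_count 0 = 1"
proof -
  have "{\<sigma>\<in>\<Gamma>. card \<sigma> = 0} = {{}}" using empty_face finite_face by auto
  then show ?thesis by (simp add: face_count_def)
qed

lemma face_count_1: "face_count 1 = n"
proof -
  have "{\<sigma>\<in>\<Gamma>. card \<sigma> = 1} = (\<lambda>i. {i}) ` {1..n}"
    using simplicial face_subset by (auto simp: simplicial_complex_def card_1_singleton_iff)
  then show ?thesis by (simp add: face_count_def card_image)
qed

lemma euler_average_0: "euler_average 0 = 1"
proof -
  have "euler_average 0 = (\<Sum>s\<in>{0}. euler_coeff s * real (0 choose s))"
    unfolding euler_average_def by (rule sum.mono_neutral_right) auto
  then show ?thesis by (simp add: euler_coeff_def face_count_0)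
qed

text \<open>Only sizes 0 and 1 contribute, giving \<open>1 - n / n\<close>; here
  \<open>n > 0\<close> because \<open>1 \<le> d \<le> n\<close>.\<close>

lemma euler_average_1:
  assumes "1 \<le> d"
  shows "euler_average 1 = 0"
proof -
  have "euler_average 1 = (\<Sum>s\<in>{0,1}. euler_coeff s * real (1 choose s))"
    unfolding euler_average_def
    by (rule sum.mono_neutral_right) (use assms in \<open>auto simp: binomial_eq_0\<close>)
  then show ?thesis using assms dim_le by (simp add: euler_coeff_def face_count_0 face_count_1[simplified])
qed

text \<open>Shifts and skips partition \<open>{1..n}\<close>, and both are listed without
  repetition.\<close>

lemma prod_shifts_skips:
  "(\<Prod>i=1..n-d. real (M i)) * (\<Prod>u<d. real (Q u)) = fact n"
proof -
  have "(\<Prod>i=1..n-d. M i) * (\<Prod>u<d. Q u) = \<Prod>(M ` {1..n - d}) * \<Prod>skips"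
    using prod.reindex[OF Mshift_inj, of "\<lambda>x. x"] prod.reindex[OF upper_skip_inj, of "\<lambda>x. x"]
    by (simp add: upper_skip_image)
  also have "\<dots> = \<Prod>{1..n}"
    unfolding skips_def by (metis Mshift_image_subset finite_atLeastAtMost mult.commute prod.subset_diff)
  also have "\<dots> = fact n" by (simp add: fact_prod)
  finally have "real ((\<Prod>i=1..n-d. M i) * (\<Prod>u<d. Q u)) = real (fact n)" by simp
  then show ?thesis by simp
qed

text \<open>The product identity and \<open>Q 0 = 1\<close> turn the bound on the face number into
  \<open>c / ?q\<close>; after division by \<open>c\<close> it concerns the top coefficient of the
  polynomial \<open>euler_average\<close>, to which \<open>skip_criterion\<close> applies.\<close>

lemma criterion:
  "real (fvec \<Gamma> (d - 1)) \<le> (\<Prod>i=1..n-d. real (M i)) / fact (n - d) \<longleftrightarrow>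
     (\<Sum>i=1..d-1. ccoef Q d i * (\<Sum>j=0..i-1. (-1) ^ (i - j - 1) * Aavg K n \<Gamma> j (Q i))) \<ge> 0"
proof (cases "d = 0")
  case True
  \<comment> \<open>For \<open>d = 0\<close> the index \<open>d - 1\<close> truncates to 0. There
    are no vertices, the sum over skips is empty, and both sides of the equivalence hold.\<close>
  then have none: "{\<sigma>\<in>\<Gamma>. card \<sigma> = 0 + 1} = {}" using card_face_le by fastforce
  have "fvec \<Gamma> 0 = 0" unfolding fvec_def none by simp
  then show ?thesis using True by (simp add: prod_nonneg)
next
  case False
  then have d: "1 \<le> d" by simp
  let ?q = "\<Prod>u\<in>{1..d-1}. real (Q u)"
  have "(\<Prod>u<d. real (Q u)) = ?q"
  proof -
    have "{..<d} = insert 0 {1..d-1}" using d by auto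
    then show ?thesis using upper_skip_0[OF d] by simp
  qed
  then have MQ: "(\<Prod>i=1..n-d. real (M i)) * ?q = fact n" using prod_shifts_skips by simp
  have q: "?q > 0"
  proof (rule prod_pos)
    fix u assume "u \<in> {1..d-1}"
    then have "u < d" using d by auto
    then show "0 < real (Q u)" using upper_skip_range[of u] by simp
  qed
  have fv: "fvec \<Gamma> (d - 1) = face_count d" using d by (simp add: fvec_def face_count_def)
  \<comment> \<open>This is \<open>fact n / fact (n - d)\<close>, written to match the denominators
    in \<open>euler_coeff d / fact d\<close>.\<close>
  define c where "c = real (n choose d) * fact d"
  have c: "c > 0" using dim_le by (simp add: c_def)
  have "fact n = c * fact (n - d)"
    unfolding c_def binomial_fact[OF dim_le] by simp
  with MQ have "(\<Prod>i=1..n-d. real (M i)) * ?q = c * fact (n - d)" by simp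
  moreover have "fact (n - d) \<noteq> (0::real)" "?q \<noteq> 0" by simp (rule less_imp_neq[OF q, symmetric])
  ultimately have "(\<Prod>i=1..n-d. real (M i)) / fact (n - d) = c / ?q"
    by (subst frac_eq_eq)
  then have "real (fvec \<Gamma> (d - 1)) \<le> (\<Prod>i=1..n-d. real (M i)) / fact (n - d) \<longleftrightarrow> real (face_count d) / c \<le> 1 / ?q"
    using c q fv by (simp add: field_simps)
  also have "real (face_count d) / c = (-1) ^ d * euler_coeff d / fact d"
    by (simp add: c_def euler_coeff_def flip: power_add mult.assoc)
  also have "\<dots> \<le> 1 / ?q \<longleftrightarrow> (\<Sum>i=1..d-1. ccoef Q d i * ((-1) ^ i * euler_average (Q i))) \<ge> 0"
    unfolding euler_average_def
    by (rule skip_criterion)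
       (use d upper_skip_0 upper_skip_less euler_average_0 euler_average_1 in \<open>auto simp: euler_average_def\<close>)
  also have "(\<Sum>i=1..d-1. ccoef Q d i * ((-1) ^ i * euler_average (Q i)))
      = (\<Sum>i=1..d-1. ccoef Q d i * (\<Sum>j=0..i-1. (-1) ^ (i - j - 1) * Aavg K n \<Gamma> j (Q i)))"
    by (rule sum.cong) (simp_all only: euler_average_skip)
  finally show ?thesis .
qed

end

theorem theorem2p2:
  fixes K :: "'k::field itself" and n d :: nat and \<Gamma> :: "nat set set"
  assumes "simplicial_complex n \<Gamma>"
    and "d = Max (card ` \<Gamma>)"
  shows "real (fvec \<Gamma> (d - 1)) \<le> (\<Prod>i=1..n-d. real (Mshift K n \<Gamma> i)) / fact (n - d)
     \<longleftrightarrow>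
     (\<Sum>i=1..d-1. ccoef (upper_skip K n d \<Gamma>) d i *
        (\<Sum>j=0..i-1. (-1) ^ (i - j - 1) * Aavg K n \<Gamma> j (upper_skip K n d \<Gamma> i))) \<ge> 0"
  by (rule labelled_complex.criterion, unfold_locales) (fact assms)+

end
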